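(* Let $C$ be a smooth irreducible curve of degree $d$. Let $n\in\mathbb{N}$. Let $\tilde C$ be the curve obtained by Uludağ's construction in such a way that its fundamental group is a central extension of $G=\pi_1(\mathbb{P}^2-C)=\mathbb{Z}/d\mathbb{Z}$ by $\mathbb{Z}/(n+1)\mathbb{Z}$ (i.e. the construction with parameter $n$). Then for $n=1$, $\tilde C$ has an intersection point of $d$ smooth branches and one $d$-tacnode (i.e., the curve has the singularities $[d]$ and $[d_2]$). For $n\ge 2$, $\tilde C$ has a $d$-tacnode of order $n-1$, and another singular point which is a blow down of a $d$-tacnode of order $n-1$ (i.e., the curve has the singularities $[d_n]$ and $[dn,d_n]$). The degree of the resulting curve is $d(n+1)$.
   Context: Curves are complex plane projective curves and $\mathbb{N}=\{1,2,3,\dots\}$. Singularity types: if a singular point $P$ is resolved by a sequence of $s$ blow-ups, with only one singular point appearing at each blow-up, and $t_i>1$ ($1\le i\le s$) is the multiplicity of the curve at $P$ before the $i$-th blow-up, then $[t_1,\dots,t_s]$ is called the type of the singularity. A sequence of $r$ equal multiplicities $l$ is abbreviated $l_r$ (e.g. $[2,2,2]=[2_3]$). A $d$-tacnode is a singular point where $d$ smooth branches of the curve have a common tangent at the same point; a $d$-tacnode of order $k$ is a $d$-tacnode such that the higher derivatives of the branches are also equal up to order $k$ (the usual tacnode is a $2$-tacnode of order $1$). A blow down of a $d$-tacnode is the singular point obtained from a $d$-tacnode located on an exceptional curve when that curve is blown down. The Hirzebruch surface $F_n$ is the $\mathbb{P}^1$-bundle over $\mathbb{P}^1$ whose exceptional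 section has self-intersection $-n$. Elementary transformations: the first type ($F_n$ to $F_{n+1}$) blows up a point on the exceptional section and then blows down the proper transform of the fiber through that point. The second type ($F_n$ to $F_{n-1}$) blows up a point on a fiber $Q$, outside the exceptional section, and then blows down the proper transform of $Q$. In both cases the transformation is said to be performed on that fiber; the new fiber (the exceptional curve of the blow-up) replaces the old one and is called its proper transform. Uludağ's construction with parameter $n$: take a line $Q$ which intersects $C$ transversally and another line $P$ which also intersects $C$ transversally and meets $Q$ outside $C$. Blow up the intersection point of the two lines to get $F_1$. Apply $n$ elementary transformations of the first type, each time on the proper transform of $Q$, reaching $F_{n+1}$. Then apply $n$ elementary transformations of the second type, each time on the proper transform of $P$, returning to $F_1$. Then blow down the exceptional section to get $\mathbb{P}^2$ again. $\tilde C$ is the proper transform of $C$. *)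

theory Defs
  imports "HOL-Analysis.Analysis"
begin

section \<open>Polynomials\<close>

text \<open>Polynomials over the complex numbers are represented by the functions they define; the field
  being infinite, nothing is lost.\<close>

inductive polyn :: "(complex ^ 'n \<Rightarrow> complex) \<Rightarrow> bool" where
  const: "polyn (\<lambda>z. c)"
| coord: "polyn (\<lambda>z. z $ i)"
| add: "polyn f \<Longrightarrow> polyn g \<Longrightarrow> polyn (\<lambda>z. f z + g z)"
| mult: "polyn f \<Longrightarrow> polyn g \<Longrightarrow> polyn (\<lambda>z. f z * g z)"

definition irreducible_polyn :: "(complex ^ 'n \<Rightarrow> complex) \<Rightarrow> bool" where
  "irreducible_polyn f \<longleftrightarrow> polyn f \<and> (\<nexists>c. f = (\<lambda>z. c)) \<and>
     (\<forall>g h. polyn g \<and> polyn h \<and> f = (\<lambda>z. g z * h z) \<longrightarrow> (\<exists>c. g = (\<lambda>z. c)) \<or> (\<exists>c. h = (\<lambda>z. c)))"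

section \<open>Plane projective curves\<close>

text \<open>A curve is given by its equation. A point of the projective plane is the one-dimensional
  subspace \<open>proj_pt p\<close> spanned by a nonzero vector \<open>p\<close>, and a line is given by the nonzero vector of
  its coefficients.\<close>

definition plane_curve :: "nat \<Rightarrow> (complex ^ 3 \<Rightarrow> complex) \<Rightarrow> bool" where
  "plane_curve d F \<longleftrightarrow> polyn F \<and> F \<noteq> (\<lambda>z. 0) \<and> (\<forall>c z. F (c *s z) = c ^ d * F z)"

definition proj_pt :: "complex ^ 3 \<Rightarrow> (complex ^ 3) set" where
  "proj_pt p = range (\<lambda>c. c *s p)"

definition gradient :: "(complex ^ 'n \<Rightarrow> complex) \<Rightarrow> complex ^ 'n \<Rightarrow> complex ^ 'n" where
  "gradient F p = (\<chi> i. deriv (\<lambda>t. F (p + t *s axis i 1)) 0)"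

definition singular_points :: "(complex ^ 3 \<Rightarrow> complex) \<Rightarrow> (complex ^ 3) set set" where
  "singular_points F = {proj_pt p |p. p \<noteq> 0 \<and> F p = 0 \<and> gradient F p = 0}"

definition on_line :: "complex ^ 3 \<Rightarrow> complex ^ 3 \<Rightarrow> bool" where
  "on_line l p \<longleftrightarrow> (\<Sum>i\<in>UNIV. l $ i * p $ i) = 0"

definition transversal_line :: "(complex ^ 3 \<Rightarrow> complex) \<Rightarrow> complex ^ 3 \<Rightarrow> bool" where
  "transversal_line F l \<longleftrightarrow> l \<noteq> 0 \<and>
     (\<forall>p. p \<noteq> 0 \<and> F p = 0 \<and> on_line l p \<longrightarrow> (\<forall>c. gradient F p \<noteq> c *s l))"

section \<open>Proper transforms\<close>

text \<open>\<open>\<pi>\<close> is the blow-down map written in coordinates, and \<open>e = 0\<close> is the equation of the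
  exceptional curve: the proper transform of \<open>f\<close> is the total transform \<open>f \<circ> \<pi>\<close> stripped of the
  exceptional curve. Conversely, the curve obtained from \<open>g\<close> by blowing down \<open>e = 0\<close> is the curve
  \<open>f\<close> whose proper transform is \<open>g\<close>.\<close>

definition proper_transform ::
  "(complex ^ 'm \<Rightarrow> complex ^ 'n) \<Rightarrow> (complex ^ 'm \<Rightarrow> complex) \<Rightarrow>
   (complex ^ 'n \<Rightarrow> complex) \<Rightarrow> (complex ^ 'm \<Rightarrow> complex) \<Rightarrow> bool" where
  "proper_transform \<pi> e f g \<longleftrightarrow> polyn g \<and> (\<exists>m. \<forall>z. f (\<pi> z) = e z ^ m * g z) \<and>
     \<not> (\<exists>h. polyn h \<and> g = (\<lambda>z. e z * h z))"

section \<open>Singularities\<close>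

text \<open>A local equation at the point \<open>p\<close>, in affine coordinates centred at \<open>p\<close>. All local notions
  below refer to the origin.\<close>

definition local_equation ::
  "(complex ^ 3 \<Rightarrow> complex) \<Rightarrow> complex ^ 3 \<Rightarrow> (complex ^ 2 \<Rightarrow> complex) \<Rightarrow> bool" where
  "local_equation F p f \<longleftrightarrow> (\<exists>u v. det (vector [p, u, v] :: complex ^ 3 ^ 3) \<noteq> 0 \<and>
     f = (\<lambda>z. F (p + z $ 1 *s u + z $ 2 *s v)))"

definition mult0 :: "(complex ^ 2 \<Rightarrow> complex) \<Rightarrow> nat" where
  "mult0 f = (LEAST m. \<exists>i j. i + j = m \<and>
     (deriv ^^ i) (\<lambda>x. (deriv ^^ j) (\<lambda>y. f (vector [x, y])) 0) 0 \<noteq> 0)"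

text \<open>The blow-up of the origin, near the point of the exceptional line with slope \<open>a\<close>
  (\<open>Some a\<close>), respectively with vertical direction (\<open>None\<close>). In both charts that point is the origin
  and the exceptional line is \<open>z $ 1 = 0\<close>.\<close>

fun blowup_chart :: "complex option \<Rightarrow> complex ^ 2 \<Rightarrow> complex ^ 2" where
  "blowup_chart (Some a) z = vector [z $ 1, z $ 1 * (a + z $ 2)]"
| "blowup_chart None z = vector [z $ 1 * z $ 2, z $ 1]"

definition local_transform ::
  "complex option \<Rightarrow> (complex ^ 2 \<Rightarrow> complex) \<Rightarrow> (complex ^ 2 \<Rightarrow> complex) \<Rightarrow> bool" where
  "local_transform b f g \<longleftrightarrow> proper_transform (blowup_chart b) (\<lambda>z. z $ 1) f g"

text \<open>The type \<open>[t\<^sub>1, \<dots>, t\<^sub>s]\<close>. The empty list expresses that there is nothing left to resolve,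
  so no point other than the one being followed may be singular.\<close>

fun singularity_type :: "(complex ^ 2 \<Rightarrow> complex) \<Rightarrow> nat list \<Rightarrow> bool" where
  "singularity_type f [] \<longleftrightarrow> mult0 f \<le> 1"
| "singularity_type f (t # ts) \<longleftrightarrow> 1 < t \<and> mult0 f = t \<and>
     (\<exists>b g. local_transform b f g \<and> singularity_type g ts \<and>
        (\<forall>b' g'. b' \<noteq> b \<and> local_transform b' f g' \<longrightarrow> mult0 g' \<le> 1))"

text \<open>In the linear coordinates given by \<open>L\<close>, the curve consists near the origin of the \<open>d\<close> distinct
  smooth branches \<open>y = \<phi> i x\<close>.\<close>

definition branches ::
  "(complex ^ 2 \<Rightarrow> complex) \<Rightarrow> nat \<Rightarrow> complex ^ 2 ^ 2 \<Rightarrow> (nat \<Rightarrow> complex \<Rightarrow> complex) \<Rightarrow> bool" where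
  "branches f d L \<phi> \<longleftrightarrow> invertible L \<and>
     (\<forall>i<d. \<phi> i analytic_on {0} \<and> \<phi> i 0 = 0) \<and>
     (\<forall>i<d. \<forall>j<d. i \<noteq> j \<longrightarrow> \<not> (\<forall>\<^sub>F x in nhds 0. \<phi> i x = \<phi> j x)) \<and>
     (\<forall>\<^sub>F z in nhds 0. f (L *v z) = 0 \<longleftrightarrow> (\<exists>i<d. z $ 2 = \<phi> i (z $ 1)))"

definition agree_to_order :: "nat \<Rightarrow> (nat \<Rightarrow> complex \<Rightarrow> complex) \<Rightarrow> nat \<Rightarrow> bool" where
  "agree_to_order d \<phi> k \<longleftrightarrow>
     (\<forall>i<d. \<forall>j<d. \<forall>m\<le>k. (deriv ^^ m) (\<phi> i) 0 = (deriv ^^ m) (\<phi> j) 0)"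

definition smooth_branches_point :: "(complex ^ 2 \<Rightarrow> complex) \<Rightarrow> nat \<Rightarrow> bool" where
  "smooth_branches_point f d \<longleftrightarrow> (\<exists>L \<phi>. branches f d L \<phi>)"

definition tacnode :: "(complex ^ 2 \<Rightarrow> complex) \<Rightarrow> nat \<Rightarrow> bool" where
  "tacnode f d \<longleftrightarrow> 2 \<le> d \<and> (\<exists>L \<phi>. branches f d L \<phi> \<and> agree_to_order d \<phi> 1)"

text \<open>The order is the largest one to which all branches agree: the usual tacnode, and not the
  higher contact of two branches, has order 1.\<close>

definition tacnode_of_order :: "(complex ^ 2 \<Rightarrow> complex) \<Rightarrow> nat \<Rightarrow> nat \<Rightarrow> bool" where
  "tacnode_of_order f d k \<longleftrightarrow> 2 \<le> d \<and> 1 \<le> k \<and>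
     (\<exists>L \<phi>. branches f d L \<phi> \<and> agree_to_order d \<phi> k \<and> \<not> agree_to_order d \<phi> (Suc k))"

definition blow_down_of_tacnode :: "(complex ^ 2 \<Rightarrow> complex) \<Rightarrow> nat \<Rightarrow> nat \<Rightarrow> bool" where
  "blow_down_of_tacnode f d k \<longleftrightarrow>
     (\<exists>b g. local_transform b f g \<and> tacnode_of_order g d k \<and>
        (\<forall>b' g'. b' \<noteq> b \<and> local_transform b' f g' \<longrightarrow> g' 0 \<noteq> 0))"

section \<open>Hirzebruch surfaces\<close>

text \<open>Points of the Hirzebruch surface \<open>F\<^sub>k\<close> have homogeneous coordinates
  \<open>(x\<^sub>0, x\<^sub>1, y\<^sub>0, y\<^sub>1)\<close> with \<open>(x\<^sub>0, x\<^sub>1) \<noteq> 0 \<noteq> (y\<^sub>0, y\<^sub>1)\<close>, up to the action below. The fibration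
  is \<open>(x\<^sub>0 : x\<^sub>1)\<close>. The divisor \<open>y\<^sub>0 = 0\<close> is disjoint from \<open>y\<^sub>1 = 0\<close> and linearly equivalent to
  \<open>y\<^sub>1 = 0\<close> plus \<open>k\<close> fibers, so \<open>y\<^sub>1 = 0\<close> is the exceptional section, of self-intersection \<open>-k\<close>.
  Curves are given by polynomials which are homogeneous for the action.\<close>

definition hirz_action :: "nat \<Rightarrow> complex \<Rightarrow> complex \<Rightarrow> complex ^ 4 \<Rightarrow> complex ^ 4" where
  "hirz_action k s t z = vector [s * z $ 1, s * z $ 2, s ^ k * t * z $ 3, t * z $ 4]"

definition hirz_curve :: "nat \<Rightarrow> (complex ^ 4 \<Rightarrow> complex) \<Rightarrow> bool" where
  "hirz_curve k f \<longleftrightarrow> polyn f \<and> f \<noteq> (\<lambda>z. 0) \<and>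
     (\<exists>a b. \<forall>s t z. f (hirz_action k s t z) = s ^ a * t ^ b * f z)"

text \<open>\<open>F\<^sub>1\<close> as the blow-up of the plane: the rows of \<open>A\<close> are linear forms on the plane, and
  the exceptional section is contracted to the point where the first two of them vanish. The fiber
  \<open>x\<^sub>0 = 0\<close>, resp. \<open>x\<^sub>1 = 0\<close>, is the proper transform of the line given by the first, resp. second,
  row.\<close>

definition contract_section :: "complex ^ 3 ^ 3 \<Rightarrow> complex ^ 4 \<Rightarrow> complex ^ 3" where
  "contract_section A z = matrix_inv A *v vector [z $ 1 * z $ 4, z $ 2 * z $ 4, z $ 3]"

text \<open>Elementary transformation of the first type, from \<open>F\<^sub>k\<close> to \<open>F\<^sub>k\<^sub>+\<^sub>1\<close>, on the fiber
  \<open>x\<^sub>0 = 0\<close>. The blow-up of the point \<open>x\<^sub>0 = y\<^sub>1 = 0\<close> has homogeneous coordinates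
  \<open>(x\<^sub>0, x\<^sub>1, y\<^sub>0, y\<^sub>1, e)\<close>, where \<open>e = 0\<close> is the exceptional curve and \<open>x\<^sub>0 = 0\<close>
  is now the proper transform of the fiber. The second map blows down the latter and takes
  \<open>e = 0\<close> to the fiber \<open>x\<^sub>0 = 0\<close> of \<open>F\<^sub>k\<^sub>+\<^sub>1\<close>.\<close>

definition first_up :: "complex ^ 5 \<Rightarrow> complex ^ 4" where
  "first_up z = vector [z $ 5 * z $ 1, z $ 2, z $ 3, z $ 5 * z $ 4]"

definition first_down :: "complex ^ 5 \<Rightarrow> complex ^ 4" where
  "first_down z = vector [z $ 5 * z $ 1, z $ 2, z $ 1 * z $ 3, z $ 4]"

definition elementary_first :: "nat \<Rightarrow> (complex ^ 4 \<Rightarrow> complex) \<Rightarrow> (complex ^ 4 \<Rightarrow> complex) \<Rightarrow> bool" where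
  "elementary_first k f f' \<longleftrightarrow> hirz_curve k f \<and> hirz_curve (k + 1) f' \<and>
     (\<exists>g. proper_transform first_up (\<lambda>z. z $ 5) f g \<and>
          proper_transform first_down (\<lambda>z. z $ 1) f' g)"

text \<open>Elementary transformation of the second type, from \<open>F\<^sub>k\<close> to \<open>F\<^sub>k\<^sub>-\<^sub>1\<close>, on the fiber
  \<open>x\<^sub>1 = 0\<close>. Every point of this fiber outside the exceptional section has coordinates
  \<open>(1, 0, c, 1)\<close> for a unique \<open>c\<close>, and is the common zero of \<open>x\<^sub>1\<close> and \<open>y\<^sub>0 - c x\<^sub>0\<^sup>k y\<^sub>1\<close>. The
  blow-up of this point has homogeneous coordinates \<open>(x\<^sub>0, x\<^sub>1, w, y\<^sub>1, e)\<close>, where \<open>e = 0\<close> is the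
  exceptional curve, \<open>w = 0\<close> is the proper transform of \<open>y\<^sub>0 = c x\<^sub>0\<^sup>k y\<^sub>1\<close>, and
  \<open>x\<^sub>1 = 0\<close> is now the proper transform of the fiber.\<close>

definition second_up :: "nat \<Rightarrow> complex \<Rightarrow> complex ^ 5 \<Rightarrow> complex ^ 4" where
  "second_up k c z = vector [z $ 1, z $ 5 * z $ 2, z $ 5 * z $ 3 + c * z $ 1 ^ k * z $ 4, z $ 4]"

definition second_down :: "complex ^ 5 \<Rightarrow> complex ^ 4" where
  "second_down z = vector [z $ 1, z $ 5 * z $ 2, z $ 3, z $ 2 * z $ 4]"

definition elementary_second ::
  "nat \<Rightarrow> complex \<Rightarrow> (complex ^ 4 \<Rightarrow> complex) \<Rightarrow> (complex ^ 4 \<Rightarrow> complex) \<Rightarrow> bool" where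
  "elementary_second k c f f' \<longleftrightarrow> hirz_curve k f \<and> hirz_curve (k - 1) f' \<and>
     (\<exists>g. proper_transform (second_up k c) (\<lambda>z. z $ 5) f g \<and>
          proper_transform second_down (\<lambda>z. z $ 2) f' g)"

section \<open>Uludag's construction\<close>

text \<open>The third row of \<open>A\<close>, and the matrix \<open>B\<close>, are arbitrary choices of coordinates on the initial
  and the final plane. The curves \<open>f i\<close> lie on \<open>F\<^sub>i\<^sub>+\<^sub>1\<close>, the curves \<open>g i\<close> on \<open>F\<^sub>n\<^sub>+\<^sub>1\<^sub>-\<^sub>i\<close>.
  The centers of the transformations of the second type lie outside the curve. This is what makes
  the fundamental group of the resulting complement a central extension by a group of order
  \<open>n + 1\<close>: for an irreducible curve its abelianization is cyclic of order the degree, and a center of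
  multiplicity \<open>m\<close> on the curve lowers that degree by \<open>m\<close>.\<close>

definition uludag_construction ::
  "nat \<Rightarrow> (complex ^ 3 \<Rightarrow> complex) \<Rightarrow> (complex ^ 3 \<Rightarrow> complex) \<Rightarrow> bool" where
  "uludag_construction n C C' \<longleftrightarrow>
     (\<exists>Q P R A B f g c.
        transversal_line C Q \<and> transversal_line C P \<and>
        (\<forall>p. p \<noteq> 0 \<and> on_line Q p \<and> on_line P p \<longrightarrow> C p \<noteq> 0) \<and>
        A = vector [Q, P, R] \<and> invertible A \<and> invertible B \<and>
        proper_transform (contract_section A) (\<lambda>z. z $ 4) C (f 0) \<and>
        (\<forall>i<n. elementary_first (i + 1) (f i) (f (i + 1))) \<and>
        g 0 = f n \<and>
        (\<forall>i<n. g i (vector [1, 0, c i, 1]) \<noteq> 0 \<and>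
               elementary_second (n + 1 - i) (c i) (g i) (g (i + 1))) \<and>
        (\<exists>m. plane_curve m C') \<and>
        proper_transform (contract_section B) (\<lambda>z. z $ 4) C' (g n))"

end

theory Submission
  imports Defs "HOL-Computational_Algebra.Fundamental_Theorem_Algebra"
    "HOL-Complex_Analysis.Cauchy_Integral_Formula"
begin

text \<open>Let \<open>F = 0\<close> be the equation of \<open>C\<close> in coordinates in which \<open>Q\<close>, \<open>P\<close> are the lines \<open>x = 0\<close>,
  \<open>y = 0\<close>. No center of a blow-up lies on the curve, so the whole construction is the substitution
  \<open>F (x\<^sup>n\<^sup>+\<^sup>1, x\<^sup>n y, y\<^sup>n z + \<Sum>j<n. c j x\<^sup>n\<^sup>+\<^sup>1\<^sup>-\<^sup>j y\<^sup>j)\<close>, a map which is etale where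
  \<open>x y \<noteq> 0\<close>. On \<open>x y = 0\<close> the curve meets only \<open>(0 : 1 : 0)\<close> and \<open>(0 : 0 : 1)\<close>. At the first
  point, and after one blow-up with initial form \<open>y ^ (d n)\<close> at the second one, homogeneity of \<open>F\<close>
  turns the \<open>d\<close> transversal intersections of \<open>C\<close> with \<open>Q\<close>, resp. \<open>P\<close>, into \<open>d\<close> smooth branches
  which separate exactly at order \<open>n\<close>.\<close>

section \<open>Polynomial functions\<close>

text \<open>Up to an exchange of coordinates, and after one blow-up at the second point if
  \<open>n \<ge> 2\<close>, each local equation has the shape
  \<open>\<Psi> x (x ^ k) (y + poly r x)\<close>, where \<open>\<Psi>\<close> is homogeneous of
  degree \<open>d\<close> in its last two arguments. At \<open>x = 0\<close> it is the equation of
  the given curve on \<open>Q\<close> or \<open>P\<close>: transversality makes it square-free, and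
  a center off the curve excludes the vertical direction. Blow-up sequence and branches are both
  read off this shape. The second point for \<open>n = 1\<close> is set apart because a tacnode is
  wanted at the point itself; there the contact exponent is 2. Two obstacles shape the rest. Proper
  transforms are given by a relation, and \<open>singularity_type\<close> quantifies over all of
  them, so each must be shown unique and explicit. And the branches arise only as a choice of one
  root for each \<open>x\<close>; their analyticity comes from bounds on difference quotients, their
  completeness from counting roots.\<close>

lemma polyn_power: "polyn f \<Longrightarrow> polyn (\<lambda>z. f z ^ m)"
  by (induction m) (auto intro: polyn.intros)

lemma polyn_diff:
  assumes "polyn f" and "polyn g"
  shows "polyn (\<lambda>z. f z - g z)"
  using polyn.add[OF assms(1) polyn.mult[OF polyn.const[of "-1"] assms(2)]] by simp

lemma polyn_sum: "(\<And>i. i \<in> I \<Longrightarrow> polyn (f i)) \<Longrightarrow> polyn (\<lambda>z. \<Sum>i\<in>I. f i z)"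
  by (induction I rule: infinite_finite_induct) (auto intro: polyn.intros)

lemma polyn_poly: "polyn f \<Longrightarrow> polyn (\<lambda>z. poly p (f z))"
  by (induction p) (auto intro: polyn.intros)

lemmas polyn_intros = polyn.intros polyn_power polyn_diff polyn_sum polyn_poly

lemma polyn_compose:
  assumes "polyn F" and "\<And>i. polyn (\<lambda>z. \<phi> z $ i)"
  shows "polyn (\<lambda>z. F (\<phi> z))"
  using assms by (induction) (auto intro: polyn.intros)

lemma polyn_vector_3:
  assumes "polyn F" and "polyn a" and "polyn b" and "polyn c"
  shows "polyn (\<lambda>z. F (vector [a z, b z, c z] :: complex ^ 3))"
proof (rule polyn_compose[OF assms(1)])
  fix i :: 3
  show "polyn (\<lambda>z. (vector [a z, b z, c z] :: complex ^ 3) $ i)"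
    using exhaust_3[of i] assms by auto
qed

lemma vector_3_eta [simp]: "(vector [z $ 1, z $ 2, z $ 3] :: complex ^ 3) = z"
  by (simp add: vec_eq_iff forall_3)

lemma continuous_on_polyn: "polyn f \<Longrightarrow> continuous_on A f"
  by (induction rule: polyn.induct) (auto intro!: continuous_intros)

lemma polyn_on_curve:
  assumes "polyn F"
  shows "\<exists>p. \<forall>t. F (\<chi> i. poly (q i) t) = poly p t"
  using assms
proof induction
  case (const c)
  show ?case by (rule exI[of _ "[:c:]"]) simp
next
  case (coord i)
  show ?case by (rule exI[of _ "q i"]) simp
next
  case (add f g)
  then show ?case by (metis poly_add)
next
  case (mult f g)
  then show ?case by (metis poly_mult)
qed

lemma poly_eqI_off_0:
  fixes p q :: "complex poly"
  assumes "\<And>t. t \<noteq> 0 \<Longrightarrow> poly p t = poly q t"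
  shows "p = q"
proof -
  have "poly ([:0, 1:] * (p - q)) t = poly 0 t" for t
    using assms[of t] by (cases "t = 0") auto
  then have "[:0, 1:] * (p - q) = 0"
    using poly_eq_poly_eq_iff by blast
  then show ?thesis by auto
qed

text \<open>Through every point \<open>z\<close> passes the line on which only the
  \<open>i\<close>-th coordinate varies; on it both sides are univariate polynomials that agree off
  0.\<close>

lemma polyn_eqI_off_0:
  fixes f g :: "complex ^ 'n \<Rightarrow> complex"
  assumes "polyn f" and "polyn g" and eq: "\<And>z. z $ i \<noteq> 0 \<Longrightarrow> f z = g z"
  shows "f = g"
proof
  fix z
  define q :: "'n \<Rightarrow> complex poly" where "q j = (if j = i then [:0, 1:] else [:z $ j:])" for j
  obtain p where p: "\<And>t. f (\<chi> j. poly (q j) t) = poly p t"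
    using polyn_on_curve[OF assms(1)] by metis
  obtain p' where p': "\<And>t. g (\<chi> j. poly (q j) t) = poly p' t"
    using polyn_on_curve[OF assms(2)] by metis
  have "p = p'"
  proof (rule poly_eqI_off_0)
    fix t :: complex
    assume "t \<noteq> 0"
    then show "poly p t = poly p' t"
      unfolding p[symmetric] p'[symmetric] by (intro eq) (simp add: q_def)
  qed
  moreover have "(\<chi> j. poly (q j) (z $ i)) = z"
    by (simp add: vec_eq_iff q_def)
  ultimately show "f z = g z"
    using p[of "z $ i"] p'[of "z $ i"] by simp
qed

text \<open>Uniqueness of the proper transform: two factorizations with different exponents would
  make one cofactor divisible by \<open>z $ i\<close>. Indivisibility excludes this for
  \<open>g\<close>, the point in \<open>nonzero\<close> for \<open>h\<close>. The case
  \<open>M = 0\<close> serves blow-ups centered off the curve.\<close>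

lemma proper_transform_iff:
  fixes f :: "complex ^ 'n \<Rightarrow> complex" and g h :: "complex ^ 'm \<Rightarrow> complex"
  assumes h: "polyn h" and total: "\<And>z. f (\<pi> z) = (z $ i) ^ M * h z"
    and nonzero: "\<exists>z. z $ i = 0 \<and> h z \<noteq> 0"
  shows "proper_transform \<pi> (\<lambda>z. z $ i) f g \<longleftrightarrow> g = h"
proof
  assume "g = h"
  then show "proper_transform \<pi> (\<lambda>z. z $ i) f g"
    using assms unfolding proper_transform_def by auto
next
  assume "proper_transform \<pi> (\<lambda>z. z $ i) f g"
  then obtain m where g: "polyn g" and m: "\<And>z. f (\<pi> z) = (z $ i) ^ m * g z"
    and ndvd: "\<And>h. polyn h \<Longrightarrow> g \<noteq> (\<lambda>z. z $ i * h z)"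
    unfolding proper_transform_def by blast
  have eq: "(z $ i) ^ m * g z = (z $ i) ^ M * h z" for z
    using m[of z] total[of z] by simp
  consider "m < M" | "M < m" | "m = M"
    by linarith
  then show "g = h"
  proof cases
    case 1
    then obtain k where k: "M = m + Suc k"
      using less_iff_Suc_add by auto
    have "g = (\<lambda>z. z $ i * ((z $ i) ^ k * h z))"
    proof (rule polyn_eqI_off_0[where i = i])
      show "g z = z $ i * ((z $ i) ^ k * h z)" if "z $ i \<noteq> 0" for z
        using eq[of z] that by (simp add: k power_add)
    qed (auto intro!: polyn_intros g h)
    then show ?thesis
      using ndvd[of "\<lambda>z. (z $ i) ^ k * h z"] polyn.mult[OF polyn_power[OF polyn.coord] h] by blast
  next
    case 2
    then obtain k where k: "m = M + Suc k"
      using less_iff_Suc_add by auto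
    have "h = (\<lambda>z. (z $ i) ^ Suc k * g z)"
    proof (rule polyn_eqI_off_0[where i = i])
      show "h z = (z $ i) ^ Suc k * g z" if "z $ i \<noteq> 0" for z
        using eq[of z] that by (simp add: k power_add mult.assoc)
    qed (auto intro!: polyn_power polyn.intros g h)
    then have "h z = 0" if "z $ i = 0" for z
      using that by (metis power_0_Suc mult_zero_left)
    then show ?thesis
      using nonzero by blast
  next
    case 3
    then show ?thesis
      using eq by (intro polyn_eqI_off_0[where i = i] g h) auto
  qed
qed

section \<open>Derivatives\<close>

lemma sum_axis_left: "(\<Sum>j\<in>UNIV. axis i (1 :: complex) $ j * c j) = c i"
  by (subst sum.remove[of _ i]) (auto simp: axis_def)

lemma sum_axis_right: "(\<Sum>j\<in>UNIV. c j * axis i (1 :: complex) $ j) = c i"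
  using sum_axis_left[of i c] by (simp add: mult.commute)

lemma has_field_derivative_polyn:
  assumes "polyn F" and "\<And>i. ((\<lambda>t. \<gamma> t $ i) has_field_derivative \<gamma>' i) (at t)"
  shows "((\<lambda>t. F (\<gamma> t)) has_field_derivative (\<Sum>i\<in>UNIV. gradient F (\<gamma> t) $ i * \<gamma>' i)) (at t)"
proof -
  \<comment> \<open>The induction asks for some covector that is valid along all curves through
    \<open>p\<close>; testing it on the axis directions then identifies it with the
    gradient.\<close>
  let ?chain = "\<lambda>p c. \<forall>\<gamma> \<gamma>' t. \<gamma> t = p \<longrightarrow> (\<forall>i. ((\<lambda>t. \<gamma> t $ i) has_field_derivative \<gamma>' i) (at t)) \<longrightarrow>
    ((\<lambda>t. F (\<gamma> t)) has_field_derivative (\<Sum>i\<in>UNIV. c $ i * \<gamma>' i)) (at t)"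
  have "\<exists>c :: complex ^ 'a. ?chain p c" for p
    using assms(1)
  proof induction
    case (const c)
    show ?case by (rule exI[of _ 0]) simp
  next
    case (coord i)
    show ?case by (rule exI[of _ "axis i 1"]) (auto simp: sum_axis_left)
  next
    case (add f g)
    then obtain a b where "\<And>\<gamma> \<gamma>' t. \<gamma> t = p \<Longrightarrow> (\<forall>i. ((\<lambda>t. \<gamma> t $ i) has_field_derivative \<gamma>' i) (at t)) \<Longrightarrow>
        ((\<lambda>t. f (\<gamma> t)) has_field_derivative (\<Sum>i\<in>UNIV. a $ i * \<gamma>' i)) (at t)"
      and "\<And>\<gamma> \<gamma>' t. \<gamma> t = p \<Longrightarrow> (\<forall>i. ((\<lambda>t. \<gamma> t $ i) has_field_derivative \<gamma>' i) (at t)) \<Longrightarrow>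
        ((\<lambda>t. g (\<gamma> t)) has_field_derivative (\<Sum>i\<in>UNIV. b $ i * \<gamma>' i)) (at t)"
      by metis
    then show ?case
      by (intro exI[of _ "a + b"])
        (auto simp: algebra_simps sum.distrib intro!: DERIV_add)
  next
    case (mult f g)
    then obtain a b where *: "\<And>\<gamma> \<gamma>' t. \<gamma> t = p \<Longrightarrow> (\<forall>i. ((\<lambda>t. \<gamma> t $ i) has_field_derivative \<gamma>' i) (at t)) \<Longrightarrow>
        ((\<lambda>t. f (\<gamma> t)) has_field_derivative (\<Sum>i\<in>UNIV. a $ i * \<gamma>' i)) (at t)"
      and **: "\<And>\<gamma> \<gamma>' t. \<gamma> t = p \<Longrightarrow> (\<forall>i. ((\<lambda>t. \<gamma> t $ i) has_field_derivative \<gamma>' i) (at t)) \<Longrightarrow>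
        ((\<lambda>t. g (\<gamma> t)) has_field_derivative (\<Sum>i\<in>UNIV. b $ i * \<gamma>' i)) (at t)"
      by metis
    have "((\<lambda>t. f (\<gamma> t) * g (\<gamma> t)) has_field_derivative
        (\<Sum>i\<in>UNIV. (g p *s a + f p *s b) $ i * \<gamma>' i)) (at t)"
      if "\<gamma> t = p" "\<forall>i. ((\<lambda>t. \<gamma> t $ i) has_field_derivative \<gamma>' i) (at t)" for \<gamma> \<gamma>' t
    proof -
      have "(\<Sum>i\<in>UNIV. (g p *s a + f p *s b) $ i * \<gamma>' i) =
          (\<Sum>i\<in>UNIV. a $ i * \<gamma>' i) * g (\<gamma> t) + (\<Sum>i\<in>UNIV. b $ i * \<gamma>' i) * f (\<gamma> t)"
        by (simp add: that(1) sum_distrib_left sum.distrib algebra_simps)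
      then show ?thesis
        using DERIV_mult[OF *[OF that] **[OF that]] by metis
    qed
    then show ?case by (intro exI[of _ "g p *s a + f p *s b"]) blast
  qed
  then obtain c :: "complex ^ 'a" where c: "?chain (\<gamma> t) c"
    by blast
  have "gradient F (\<gamma> t) = c"
  proof (rule vec_eq_iff[THEN iffD2], rule allI)
    fix j
    let ?l = "\<lambda>s. \<gamma> t + s *s axis j 1"
    have "((\<lambda>s. ?l s $ i) has_field_derivative (axis j 1 :: complex ^ 'a) $ i) (at 0)" for i
      by (auto intro!: derivative_eq_intros simp: axis_def)
    then have "((\<lambda>s. F (?l s)) has_field_derivative (\<Sum>i\<in>UNIV. c $ i * axis j 1 $ i)) (at 0)"
      using c[rule_format, of ?l 0] by simp
    then show "gradient F (\<gamma> t) $ j = c $ j"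
      unfolding gradient_def by (simp add: DERIV_imp_deriv sum_axis_right)
  qed
  then show ?thesis
    using c assms(2) by blast
qed

text \<open>The factors \<open>D\<close> are continuous up to the diagonal, where they become the
  partial derivatives; this is what the analysis of simple roots rests on.\<close>

lemma polyn_difference_quotients:
  assumes "polyn F"
  shows "\<exists>D. (\<forall>i. continuous_on UNIV (\<lambda>p. D i (fst p) (snd p))) \<and>
    (\<forall>z w. F z - F w = (\<Sum>i\<in>UNIV. (z $ i - w $ i) * D i z w))"
  using assms
proof induction
  case (const c)
  show ?case by (rule exI[of _ "\<lambda>_ _ _. 0"]) simp
next
  case (coord j)
  show ?case
    by (rule exI[of _ "\<lambda>i _ _. if i = j then 1 else 0"]) (auto simp: if_distrib cong: if_cong)
next
  case (add f g)
  from add.IH(1) obtain D where D: "\<forall>i. continuous_on UNIV (\<lambda>p. D i (fst p) (snd p))"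
    "\<forall>z w. f z - f w = (\<Sum>i\<in>UNIV. (z $ i - w $ i) * D i z w)"
    by (elim exE conjE)
  from add.IH(2) obtain E where E: "\<forall>i. continuous_on UNIV (\<lambda>p. E i (fst p) (snd p))"
    "\<forall>z w. g z - g w = (\<Sum>i\<in>UNIV. (z $ i - w $ i) * E i z w)"
    by (elim exE conjE)
  have "f z + g z - (f w + g w) = (\<Sum>i\<in>UNIV. (z $ i - w $ i) * (D i z w + E i z w))" for z w
  proof -
    have "f z + g z - (f w + g w) = (f z - f w) + (g z - g w)" by simp
    then show ?thesis
      by (simp only: D(2)[rule_format] E(2)[rule_format]) (simp add: distrib_left sum.distrib)
  qed
  with D(1) E(1) show ?case
    by (intro exI[of _ "\<lambda>i z w. D i z w + E i z w"]) (auto intro!: continuous_on_add)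
next
  case (mult f g)
  from mult.IH(1) obtain D where D: "\<forall>i. continuous_on UNIV (\<lambda>p. D i (fst p) (snd p))"
    "\<forall>z w. f z - f w = (\<Sum>i\<in>UNIV. (z $ i - w $ i) * D i z w)"
    by (elim exE conjE)
  from mult.IH(2) obtain E where E: "\<forall>i. continuous_on UNIV (\<lambda>p. E i (fst p) (snd p))"
    "\<forall>z w. g z - g w = (\<Sum>i\<in>UNIV. (z $ i - w $ i) * E i z w)"
    by (elim exE conjE)
  have cont: "continuous_on UNIV (\<lambda>p. f (snd p))" "continuous_on UNIV (\<lambda>p. g (fst p))"
    by (auto intro!: continuous_on_compose2[OF continuous_on_polyn[OF mult.hyps(1), of UNIV]]
        continuous_on_compose2[OF continuous_on_polyn[OF mult.hyps(2), of UNIV]] continuous_intros)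
  have "f z * g z - f w * g w = (\<Sum>i\<in>UNIV. (z $ i - w $ i) * (D i z w * g z + f w * E i z w))" for z w
  proof -
    have "f z * g z - f w * g w = (f z - f w) * g z + f w * (g z - g w)"
      by (simp add: algebra_simps)
    also have "\<dots> = (\<Sum>i\<in>UNIV. (z $ i - w $ i) * (D i z w * g z + f w * E i z w))"
      by (simp only: D(2)[rule_format] E(2)[rule_format]) (simp add: sum_distrib_left sum_distrib_right sum.distrib distrib_left mult_ac)
    finally show ?thesis .
  qed
  with D(1) E(1) cont show ?case
    by (intro exI[of _ "\<lambda>i z w. D i z w * g z + f w * E i z w"]) (auto intro!: continuous_intros)
qed

section \<open>Multiplicity of a plane curve at the origin\<close>

text \<open>The outer variable is \<open>y\<close> and the coefficients are polynomials in
  \<open>x\<close>, so \<open>coeff (coeff Q j) i\<close> belongs to the monomial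
  \<open>x^i y^j\<close>.\<close>

definition bipoly :: "complex poly poly \<Rightarrow> complex \<Rightarrow> complex \<Rightarrow> complex" where
  "bipoly Q x y = poly (poly Q [:y:]) x"

lemma bipoly_0 [simp]: "bipoly 0 x y = 0"
  by (simp add: bipoly_def)

lemma bipoly_pCons [simp]: "bipoly (pCons p Q) x y = poly p x + y * bipoly Q x y"
  by (simp add: bipoly_def)

lemma bipoly_add: "bipoly (P + Q) x y = bipoly P x y + bipoly Q x y"
  by (simp add: bipoly_def)

lemma bipoly_smult: "bipoly (smult p Q) x y = poly p x * bipoly Q x y"
  by (simp add: bipoly_def)

lemma bipoly_mult: "bipoly (P * Q) x y = bipoly P x y * bipoly Q x y"
  by (simp add: bipoly_def)

lemma bipoly_eq_poly: "bipoly Q x y = poly (map_poly (\<lambda>c. poly c x) Q) y"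
  by (induction Q) (auto simp: map_poly_pCons)

lemma bipoly_eqI:
  assumes "\<And>x y. bipoly P x y = bipoly Q x y"
  shows "P = Q"
proof (rule poly_eqI)
  fix j
  have "map_poly (\<lambda>c. poly c x) P = map_poly (\<lambda>c. poly c x) Q" for x
    using assms by (simp add: bipoly_eq_poly poly_eq_poly_eq_iff[symmetric] fun_eq_iff)
  then have "coeff (map_poly (\<lambda>c. poly c x) P) j = coeff (map_poly (\<lambda>c. poly c x) Q) j" for x
    by simp
  then have "poly (coeff P j) x = poly (coeff Q j) x" for x
    by (simp add: coeff_map_poly)
  then show "coeff P j = coeff Q j"
    using poly_eq_poly_eq_iff by blast
qed

lemma polyn_on_surface:
  assumes "polyn F"
  shows "\<exists>Q. \<forall>x y. F (\<chi> i. bipoly (q i) x y) = bipoly Q x y"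
  using assms
proof induction
  case (const c)
  show ?case by (rule exI[of _ "[:[:c:]:]"]) simp
next
  case (coord i)
  show ?case by (rule exI[of _ "q i"]) simp
next
  case (add f g)
  then show ?case by (metis bipoly_add)
next
  case (mult f g)
  then show ?case by (metis bipoly_mult)
qed

lemma polyn_2_bipoly:
  fixes f :: "complex ^ 2 \<Rightarrow> complex"
  assumes "polyn f"
  obtains Q where "\<And>x y. f (vector [x, y]) = bipoly Q x y"
proof -
  define q :: "2 \<Rightarrow> complex poly poly" where "q = (\<lambda>i. if i = 1 then [:[:0, 1:]:] else [:0, 1:])"
  have "(\<chi> i. bipoly (q i) x y) = vector [x, y]" for x y
    by (simp add: vec_eq_iff forall_2 q_def)
  then show thesis
    using polyn_on_surface[OF assms, of q] that by metis
qed

lemma polyn_3_bipoly: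
  fixes f :: "complex ^ 3 \<Rightarrow> complex"
  assumes "polyn f"
  obtains Q where "\<And>x y. f (vector [x, c, y]) = bipoly Q x y"
proof -
  define q :: "3 \<Rightarrow> complex poly poly" where
    "q = (\<lambda>i. if i = 1 then [:[:0, 1:]:] else if i = 2 then [:[:c:]:] else [:0, 1:])"
  have "(\<chi> i. bipoly (q i) x y) = vector [x, c, y]" for x y
    by (simp add: vec_eq_iff forall_3 q_def)
  then show thesis
    using polyn_on_surface[OF assms, of q] that by metis
qed

section \<open>Taylor coefficients at the origin\<close>

lemma deriv_poly: "deriv (poly p) = poly (pderiv (p :: complex poly))"
  by (simp add: fun_eq_iff DERIV_imp_deriv)

lemma higher_deriv_poly: "(deriv ^^ m) (poly p) = poly ((pderiv ^^ m) (p :: complex poly))"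
  by (induction m) (simp_all add: deriv_poly)

lemma higher_deriv_poly_0: "(deriv ^^ m) (poly p) 0 = fact m * coeff (p :: complex poly) m"
  using coeff_higher_pderiv[of m p 0]
  by (simp add: higher_deriv_poly poly_0_coeff_0 pochhammer_fact)

text \<open>The iterated derivatives tested by \<open>mult0\<close> become coefficients, up to a
  nonzero factor.\<close>

lemma taylor_coeff_bipoly:
  "(deriv ^^ i) (\<lambda>x. (deriv ^^ j) (\<lambda>y. bipoly Q x y) 0) 0 = fact i * fact j * coeff (coeff Q j) i"
proof -
  have "(deriv ^^ j) (\<lambda>y. bipoly Q x y) 0 = poly (smult (fact j) (coeff Q j)) x" for x
    using higher_deriv_poly_0[of j "map_poly (\<lambda>c. poly c x) Q"]
    by (simp add: bipoly_eq_poly[abs_def] coeff_map_poly)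
  then show ?thesis
    using higher_deriv_poly_0[of i "smult (fact j) (coeff Q j)"] by (simp add: poly_smult[abs_def] mult.assoc)
qed

text \<open>Grouping \<open>f\<close> by homogeneous parts, \<open>f (t *s w) = t ^ d * h t w\<close> where \<open>h 0\<close> is the initial
  form. The value of \<open>h\<close> at a direction is the proper transform in the corresponding chart of the
  blow-up.\<close>

definition direction :: "complex option \<Rightarrow> complex \<Rightarrow> complex ^ 2" where
  "direction b s = (case b of Some a \<Rightarrow> vector [1, a + s] | None \<Rightarrow> vector [s, 1])"

text \<open>The last conjunct says that the initial form is nonzero, in the shape needed in each
  chart: the exceptional line is not a component of \<open>h\<close>.\<close>

definition initial_expansion ::
  "nat \<Rightarrow> (complex ^ 2 \<Rightarrow> complex) \<Rightarrow> (complex \<Rightarrow> complex ^ 2 \<Rightarrow> complex) \<Rightarrow> bool" where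
  "initial_expansion d f h \<longleftrightarrow> polyn f \<and> polyn (\<lambda>z :: complex ^ 3. h (z $ 1) (vector [z $ 2, z $ 3])) \<and>
     (\<forall>t w. f (t *s w) = t ^ d * h t w) \<and> (\<forall>b. \<exists>s. h 0 (direction b s) \<noteq> 0)"

lemma blowup_chart_eq: "blowup_chart b z = z $ 1 *s direction b (z $ 2)"
  by (cases b) (auto simp: direction_def vec_eq_iff forall_2)

lemma polyn_initial_expansion_chart:
  assumes "initial_expansion d f h"
  shows "polyn (\<lambda>z :: complex ^ 2. h (z $ 1) (direction b (z $ 2)))"
proof -
  have *: "polyn (\<lambda>z :: complex ^ 3. h (z $ 1) (vector [z $ 2, z $ 3]))"
    using assms by (simp add: initial_expansion_def)
  have "polyn (\<lambda>z :: complex ^ 2. h (z $ 1) (vector [z $ 2, 1]))"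
    using polyn_vector_3[OF *, of "\<lambda>z :: complex ^ 2. z $ 1" "\<lambda>z. z $ 2" "\<lambda>z. 1"]
    by (simp add: polyn_intros)
  moreover have "polyn (\<lambda>z :: complex ^ 2. h (z $ 1) (vector [1, a + z $ 2]))" for a
    using polyn_vector_3[OF *, of "\<lambda>z :: complex ^ 2. z $ 1" "\<lambda>z. 1" "\<lambda>z. a + z $ 2"]
    by (simp add: polyn_intros)
  ultimately show ?thesis
    by (cases b) (auto simp: direction_def)
qed

lemma local_transform_iff:
  assumes "initial_expansion d f h"
  shows "local_transform b f g \<longleftrightarrow> g = (\<lambda>z. h (z $ 1) (direction b (z $ 2)))"
  unfolding local_transform_def
proof (rule proper_transform_iff[where M = d])
  show "polyn (\<lambda>z :: complex ^ 2. h (z $ 1) (direction b (z $ 2)))"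
    by (rule polyn_initial_expansion_chart[OF assms])
  show "f (blowup_chart b z) = z $ 1 ^ d * h (z $ 1) (direction b (z $ 2))" for z
    using assms by (simp add: initial_expansion_def blowup_chart_eq)
  obtain s where "h 0 (direction b s) \<noteq> 0"
    using assms unfolding initial_expansion_def by blast
  then show "\<exists>z :: complex ^ 2. z $ 1 = 0 \<and> h (z $ 1) (direction b (z $ 2)) \<noteq> 0"
    by (intro exI[of _ "vector [0, s]"]) simp
qed

lemma mult0_eq:
  assumes "initial_expansion d f h"
  shows "mult0 f = d"
proof -
  obtain Q where Q: "\<And>x y. f (vector [x, y]) = bipoly Q x y"
    using polyn_2_bipoly assms unfolding initial_expansion_def by blast
  obtain H where H: "\<And>t y. h t (vector [1, y]) = bipoly H t y"
  proof -
    have "polyn (\<lambda>z :: complex ^ 2. h (z $ 1) (direction (Some 0) (z $ 2)))"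
      by (rule polyn_initial_expansion_chart[OF assms])
    from polyn_2_bipoly[OF this] show thesis
      using that by (auto simp: direction_def)
  qed
  \<comment> \<open>Composition with \<open>[:0, [:0, 1:]:]\<close> is the substitution of
    \<open>x * y\<close> for \<open>y\<close>, the pullback to the chart of slope 0.\<close>
  have "bipoly (pcompose Q [:0, [:0, 1:]:]) t y = bipoly ([:monom 1 d:] * H) t y" for t y
  proof -
    have "t *s vector [1, y] = (vector [t, t * y] :: complex ^ 2)"
      by (simp add: vec_eq_iff forall_2)
    then have "f (vector [t, t * y]) = t ^ d * h t (vector [1, y])"
      using assms unfolding initial_expansion_def by metis
    moreover have "bipoly (pcompose Q [:0, [:0, 1:]:]) t y = bipoly Q t (t * y)"
      by (induction Q) (simp_all add: pcompose_pCons bipoly_add bipoly_mult bipoly_smult algebra_simps)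
    ultimately show ?thesis
      by (simp add: Q H bipoly_mult bipoly_smult poly_monom)
  qed
  then have eq: "pcompose Q [:0, [:0, 1:]:] = [:monom 1 d:] * H"
    by (rule bipoly_eqI)
  have "coeff (pcompose Q [:0, [:0, 1:]:]) j = monom 1 j * coeff Q j" for j
  proof (induction Q arbitrary: j)
    case (pCons a Q)
    then show ?case
      by (cases j) (auto simp: pcompose_pCons coeff_pCons monom_Suc)
  qed simp
  \<comment> \<open>For each power \<open>y^j\<close> this compares \<open>x^j Q_j\<close> with
    \<open>x^d H_j\<close>. So no monomial of \<open>f\<close> has degree below \<open>d\<close>,
    and an index with \<open>H_j(0) \<noteq> 0\<close> yields the monomial
    \<open>x^(d-j) y^j\<close>.\<close>
  with eq have coeffs: "monom 1 j * coeff Q j = monom 1 d * coeff H j" for j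
    by (simp add: poly_eq_iff)
  have coeff_Q: "coeff (coeff Q j) i = (if i + j < d then 0 else coeff (coeff H j) (i + j - d))" for i j
    using arg_cong[OF coeffs[of j], of "\<lambda>p. coeff p (i + j)"] by (simp add: coeff_monom_mult)
  obtain s where "h 0 (direction (Some 0) s) \<noteq> 0"
    using assms unfolding initial_expansion_def by blast
  then have "poly (map_poly (\<lambda>c. poly c 0) H) s \<noteq> 0"
    by (simp add: direction_def H bipoly_eq_poly)
  then have "map_poly (\<lambda>c. poly c 0) H \<noteq> 0"
    by auto
  then obtain j where j: "coeff (coeff H j) 0 \<noteq> 0"
    by (auto simp: poly_eq_iff coeff_map_poly poly_0_coeff_0)
  have "coeff (monom 1 j * coeff Q j) d \<noteq> 0"
    using j unfolding coeffs by (simp add: coeff_monom_mult)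
  then have "j \<le> d" "coeff (coeff Q j) (d - j) \<noteq> 0"
    by (auto simp: coeff_monom_mult split: if_splits)
  then show ?thesis
    unfolding mult0_def Q taylor_coeff_bipoly
    by (intro Least_equality exI[of _ "d - j"] exI[of _ j]) (auto simp: coeff_Q not_less split: if_splits)
qed

text \<open>Only the derivative along the exceptional line \<open>z $ 1 = 0\<close> is tested: a
  curve that crosses it transversally is nonsingular there.\<close>

lemma mult0_le_1I:
  assumes "f 0 \<noteq> 0 \<or> deriv (\<lambda>y. f (vector [0, y])) 0 \<noteq> 0"
  shows "mult0 f \<le> 1"
proof -
  have "(vector [0, 0] :: complex ^ 2) = 0"
    by (simp add: vec_eq_iff forall_2)
  with assms consider "(deriv ^^ 0) (\<lambda>x. (deriv ^^ 0) (\<lambda>y. f (vector [x, y])) 0) 0 \<noteq> 0"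
    | "(deriv ^^ 0) (\<lambda>x. (deriv ^^ 1) (\<lambda>y. f (vector [x, y])) 0) 0 \<noteq> 0"
    by auto
  then show ?thesis
  proof cases
    case 1
    then have "mult0 f \<le> 0 + 0"
      unfolding mult0_def by (intro Least_le) blast
    then show ?thesis by simp
  next
    case 2
    then show ?thesis
      unfolding mult0_def by (intro Least_le) (metis add_0)
  qed
qed

lemma singularity_type_ConsI:
  assumes "initial_expansion d f h" and "1 < d"
    and "singularity_type (\<lambda>z. h (z $ 1) (direction b (z $ 2))) ts"
    and "\<And>b'. b' \<noteq> b \<Longrightarrow> mult0 (\<lambda>z. h (z $ 1) (direction b' (z $ 2))) \<le> 1"
  shows "singularity_type f (d # ts)"
  using assms by (auto simp: mult0_eq[OF assms(1)] local_transform_iff[OF assms(1)])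

section \<open>Singularities of smooth branches with a common contact\<close>

text \<open>A binary form in \<open>u, v\<close> with coefficients depending on \<open>x\<close>, which at \<open>x = 0\<close> is a product of
  distinct lines, none of them \<open>u = 0\<close>. Substituting \<open>x ^ k\<close> for \<open>u\<close> yields branches
  \<open>v = x ^ k * \<psi> x\<close>, the values \<open>\<psi> 0\<close> being the slopes of these lines.\<close>

locale separable_form =
  fixes \<Psi> :: "complex \<Rightarrow> complex \<Rightarrow> complex \<Rightarrow> complex" and d :: nat
  assumes polyn: "polyn (\<lambda>z :: complex ^ 3. \<Psi> (z $ 1) (z $ 2) (z $ 3))"
    and homogeneous: "\<Psi> x (t * u) (t * v) = t ^ d * \<Psi> x u v"
    and nonvertical: "\<Psi> 0 0 1 \<noteq> 0"
    and separable: "\<Psi> 0 1 v = 0 \<Longrightarrow> deriv (\<Psi> 0 1) v \<noteq> 0"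
    and d: "2 \<le> d"
begin

lemma polyn_compose_form:
  assumes "polyn a" and "polyn b" and "polyn c"
  shows "polyn (\<lambda>z. \<Psi> (a z) (b z) (c z))"
  using polyn_vector_3[OF polyn assms] by simp

lemma vertical_eq: "\<Psi> 0 0 v = v ^ d * \<Psi> 0 0 1"
  using homogeneous[of 0 v 0 1] by simp

lemma form_not_identically_0: "\<exists>v. \<Psi> 0 1 v \<noteq> 0"
proof (rule ccontr)
  assume "\<nexists>v. \<Psi> 0 1 v \<noteq> 0"
  then have "\<Psi> 0 1 = (\<lambda>v. 0)" by auto
  then show False
    using separable[of 0] by simp
qed

text \<open>With \<open>r = x r1\<close> and \<open>y = x w\<close>, homogeneity extracts
  \<open>x^d\<close> and leaves the same shape with \<open>k\<close> lowered by one and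
  \<open>r1\<close> in place of \<open>r\<close>. At \<open>k = 1\<close> the \<open>d\<close>
  distinct directions separate. The tail \<open>r\<close> is arbitrary because it changes at every
  blow-up.\<close>

lemma singularity_type_contact:
  assumes "poly r 0 = 0" and "1 \<le> k"
  shows "singularity_type (\<lambda>z. \<Psi> (z $ 1) (z $ 1 ^ k) (z $ 2 + poly r (z $ 1))) (replicate k d)"
  using assms(2,1)
proof (induction k arbitrary: r rule: dec_induct)
  case base
  then obtain r1 where r: "r = pCons 0 r1"
    by (cases r) auto
  define h where "h t w = \<Psi> (t * w $ 1) (w $ 1) (w $ 2 + w $ 1 * poly r1 (t * w $ 1))"
    for t and w :: "complex ^ 2"
  have exp: "initial_expansion d (\<lambda>z. \<Psi> (z $ 1) (z $ 1 ^ 1) (z $ 2 + poly r (z $ 1))) h"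
    unfolding initial_expansion_def
  proof (intro conjI allI)
    fix t and w :: "complex ^ 2"
    show "\<Psi> ((t *s w) $ 1) ((t *s w) $ 1 ^ 1) ((t *s w) $ 2 + poly r ((t *s w) $ 1)) = t ^ d * h t w"
      by (simp add: h_def r homogeneous[symmetric] algebra_simps)
  next
    fix b
    obtain v where "\<Psi> 0 1 v \<noteq> 0"
      using form_not_identically_0 by blast
    then show "\<exists>s. h 0 (direction b s) \<noteq> 0"
      using nonvertical
      by (cases b) (auto simp: h_def direction_def intro: exI[of _ 0] exI[of _ "v - the b - poly r1 0"])
  qed (auto simp: h_def intro!: polyn_compose_form polyn_intros)
  \<comment> \<open>On the exceptional line the transform restricts to a translate of
    \<open>\<Psi> 0 1\<close>, whose zeros are simple.\<close>
  have "mult0 (\<lambda>z. h (z $ 1) (direction b (z $ 2))) \<le> 1" for b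
  proof (rule mult0_le_1I)
    show "h ((0 :: complex ^ 2) $ 1) (direction b ((0 :: complex ^ 2) $ 2)) \<noteq> 0 \<or>
      deriv (\<lambda>y. h ((vector [0, y] :: complex ^ 2) $ 1) (direction b ((vector [0, y] :: complex ^ 2) $ 2))) 0 \<noteq> 0"
    proof (cases b)
      case None
      then show ?thesis
        using nonvertical by (simp add: h_def direction_def)
    next
      case (Some a)
      let ?v = "a + poly r1 0"
      have "(\<lambda>y. h ((vector [0, y] :: complex ^ 2) $ 1) (direction b ((vector [0, y] :: complex ^ 2) $ 2))) =
          (\<lambda>y. \<Psi> 0 1 (y + ?v))"
        by (simp add: h_def direction_def Some algebra_simps)
      moreover have "deriv (\<lambda>y. \<Psi> 0 1 (y + ?v)) 0 = deriv (\<Psi> 0 1) ?v"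
        using higher_deriv_shift_0[of 1 "\<Psi> 0 1" ?v] by (simp add: o_def add.commute)
      ultimately show ?thesis
        using separable[of ?v] by (auto simp: h_def direction_def Some)
    qed
  qed
  then show ?case
    using d singularity_type_ConsI[OF exp, where ts = "[]"] by simp
next
  case (step m)
  then obtain r1 where r: "r = pCons 0 r1"
    by (cases r) auto
  let ?c = "poly r1 0"
  define h where "h t w = \<Psi> (t * w $ 1) (t ^ m * w $ 1 ^ Suc m) (w $ 2 + w $ 1 * poly r1 (t * w $ 1))"
    for t and w :: "complex ^ 2"
  have h_0: "h 0 w = (w $ 2 + w $ 1 * ?c) ^ d * \<Psi> 0 0 1" for w
    using step.hyps(1) vertical_eq[of "w $ 2 + w $ 1 * ?c"] by (simp add: h_def power_0_left)
  have exp: "initial_expansion d (\<lambda>z. \<Psi> (z $ 1) (z $ 1 ^ Suc m) (z $ 2 + poly r (z $ 1))) h"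
    unfolding initial_expansion_def
  proof (intro conjI allI)
    fix t and w :: "complex ^ 2"
    show "\<Psi> ((t *s w) $ 1) ((t *s w) $ 1 ^ Suc m) ((t *s w) $ 2 + poly r ((t *s w) $ 1)) = t ^ d * h t w"
      by (simp add: h_def r homogeneous[symmetric] algebra_simps)
  next
    fix b
    have "h 0 (direction None 0) \<noteq> 0" "h 0 (direction (Some a) (1 - a - ?c)) \<noteq> 0" for a
      using nonvertical by (simp_all add: h_0 direction_def)
    then show "\<exists>s. h 0 (direction b s) \<noteq> 0"
      by (cases b) blast+
  qed (auto simp: h_def intro!: polyn_compose_form polyn_intros)
  \<comment> \<open>The branches share the slope \<open>- ?c\<close>. Centering the chart there
    subtracts the constant term of \<open>r1\<close>, which restores the hypothesis that the tail
    vanishes at 0.\<close>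
  have "singularity_type (\<lambda>z. \<Psi> (z $ 1) (z $ 1 ^ m) (z $ 2 + poly (r1 - [:?c:]) (z $ 1))) (replicate m d)"
    by (rule step.IH) simp
  then have "singularity_type (\<lambda>z. h (z $ 1) (direction (Some (- ?c)) (z $ 2))) (replicate m d)"
    by (simp add: h_def direction_def algebra_simps)
  moreover have "mult0 (\<lambda>z. h (z $ 1) (direction b (z $ 2))) \<le> 1" if "b \<noteq> Some (- ?c)" for b
  proof (rule mult0_le_1I)
    show "h ((0 :: complex ^ 2) $ 1) (direction b ((0 :: complex ^ 2) $ 2)) \<noteq> 0 \<or>
      deriv (\<lambda>y. h ((vector [0, y] :: complex ^ 2) $ 1) (direction b ((vector [0, y] :: complex ^ 2) $ 2))) 0 \<noteq> 0"
      using that nonvertical by (cases b) (auto simp: h_0 direction_def eq_neg_iff_add_eq_0)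
  qed
  ultimately show ?case
    using d singularity_type_ConsI[OF exp] by (simp del: singularity_type.simps)
qed

text \<open>Here the common tangent is vertical. The first blow-up is followed in the chart
  \<open>None\<close>, which exchanges the coordinates and leaves contact exponent
  \<open>k - 1\<close> with zero tail.\<close>

lemma singularity_type_contact_swapped:
  assumes "2 \<le> k"
  shows "singularity_type (\<lambda>z. \<Psi> (z $ 2) (z $ 2 ^ k) (z $ 1)) (replicate k d)"
proof -
  obtain m where k: "k = Suc m" "1 \<le> m"
    using assms by (cases k) auto
  define h where "h t w = \<Psi> (t * w $ 2) (t ^ m * w $ 2 ^ Suc m) (w $ 1)"
    for t and w :: "complex ^ 2"
  have h_0: "h 0 w = w $ 1 ^ d * \<Psi> 0 0 1" for w
    using k(2) vertical_eq[of "w $ 1"] by (simp add: h_def power_0_left)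
  have exp: "initial_expansion d (\<lambda>z. \<Psi> (z $ 2) (z $ 2 ^ k) (z $ 1)) h"
    unfolding initial_expansion_def
  proof (intro conjI allI)
    fix t and w :: "complex ^ 2"
    show "\<Psi> ((t *s w) $ 2) ((t *s w) $ 2 ^ k) ((t *s w) $ 1) = t ^ d * h t w"
      by (simp add: h_def k homogeneous[symmetric] algebra_simps)
  next
    fix b
    show "\<exists>s. h 0 (direction b s) \<noteq> 0"
      using nonvertical
      by (cases b) (auto simp: h_0 direction_def intro: exI[of _ 1])
  qed (auto simp: h_def intro!: polyn_compose_form polyn_intros)
  have "singularity_type (\<lambda>z. h (z $ 1) (direction None (z $ 2))) (replicate m d)"
    using singularity_type_contact[of 0 m] k(2) by (simp add: h_def direction_def)
  moreover have "mult0 (\<lambda>z. h (z $ 1) (direction b (z $ 2))) \<le> 1" if "b \<noteq> None" for b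
  proof (rule mult0_le_1I)
    show "h ((0 :: complex ^ 2) $ 1) (direction b ((0 :: complex ^ 2) $ 2)) \<noteq> 0 \<or>
      deriv (\<lambda>y. h ((vector [0, y] :: complex ^ 2) $ 1) (direction b ((vector [0, y] :: complex ^ 2) $ 2))) 0 \<noteq> 0"
      using that nonvertical by (cases b) (auto simp: h_0 direction_def)
  qed
  ultimately have "singularity_type (\<lambda>z. \<Psi> (z $ 2) (z $ 2 ^ k) (z $ 1)) (d # replicate m d)"
    using d by (intro singularity_type_ConsI[OF exp, where b = None]) simp_all
  then show ?thesis
    by (simp add: k(1) del: singularity_type.simps)
qed

end

section \<open>Analytic branches\<close>

text \<open>The equation \<open>f (x, \<psi> x) = f (x', \<psi> x')\<close> reads
  \<open>(\<psi> x - \<psi> x') * D 2 = - (x - x') * D 1\<close> in terms of the difference quotients \<open>D\<close> of \<open>f\<close>, and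
  \<open>D 2\<close> does not vanish near a simple root.\<close>

lemma simple_root_locally_holomorphic:
  fixes f :: "complex ^ 2 \<Rightarrow> complex"
  assumes f: "polyn f" and deriv: "deriv (\<lambda>v. f (vector [0, v])) v0 \<noteq> 0"
  obtains \<epsilon> where "0 < \<epsilon>"
    and "\<And>\<psi> \<delta>. \<delta> \<le> \<epsilon> \<Longrightarrow> (\<And>x. norm x < \<delta> \<Longrightarrow> dist (\<psi> x) v0 < \<epsilon> \<and> f (vector [x, \<psi> x]) = 0) \<Longrightarrow>
      \<psi> holomorphic_on ball 0 \<delta>"
proof -
  obtain D where cont: "\<And>i. continuous_on UNIV (\<lambda>p. D i (fst p) (snd p))"
    and D: "\<And>z w. f z - f w = (\<Sum>i\<in>UNIV. (z $ i - w $ i) * D i z w)"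
    using polyn_difference_quotients[OF f] by blast
  let ?pt = "\<lambda>x v. vector [x, v] :: complex ^ 2"
  define E where "E i x v x' v' = D i (?pt x v) (?pt x' v')" for i x v x' v'
  have E: "f (?pt x v) - f (?pt x' v') = (x - x') * E 1 x v x' v' + (v - v') * E 2 x v x' v'"
    for x v x' v'
    by (simp add: D sum_2 E_def)
  have pt_eq: "?pt x v = (\<chi> i. if i = 1 then x else v)" for x v
    by (simp add: vec_eq_iff forall_2)
  have tendsto_E: "((\<lambda>x. E i x (\<psi> x) x' v') \<longlongrightarrow> E i x' v' x' v') (at x')"
    if "(\<psi> \<longlongrightarrow> v') (at x')" for i \<psi> x' v'
  proof -
    have "((\<lambda>x. (?pt x (\<psi> x), ?pt x' v')) \<longlongrightarrow> (?pt x' v', ?pt x' v')) (at x')"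
      unfolding pt_eq by (intro tendsto_Pair tendsto_const tendsto_vec_lambda) (simp add: that)
    from continuous_on_tendsto_compose[OF cont[of i] this] show ?thesis
      by (simp add: E_def)
  qed
  \<comment> \<open>On the vertical line through the root \<open>E 2\<close> is the ordinary
    difference quotient, so its value at the base point is the nonzero derivative.\<close>
  have E2: "E 2 0 v0 0 v0 \<noteq> 0"
  proof -
    have "((\<lambda>v. (?pt 0 v, ?pt 0 v0)) \<longlongrightarrow> (?pt 0 v0, ?pt 0 v0)) (at v0)"
      unfolding pt_eq by (intro tendsto_Pair tendsto_const tendsto_vec_lambda) simp
    from continuous_on_tendsto_compose[OF cont[of 2] this]
    have "(\<lambda>v. E 2 0 v 0 v0) \<midarrow>v0\<rightarrow> E 2 0 v0 0 v0"
      by (simp add: E_def)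
    then have "((\<lambda>v. f (?pt 0 v)) has_field_derivative E 2 0 v0 0 v0) (at v0)"
      unfolding has_field_derivative_iff
      by (rule Lim_transform_eventually) (auto simp: E eventually_at_filter)
    then show ?thesis
      using deriv DERIV_imp_deriv by metis
  qed
  \<comment> \<open>A strict bound for the slope \<open>- E 1 / E 2\<close> near the base point; it
    serves as a Lipschitz constant.\<close>
  define C where "C = norm (E 1 0 v0 0 v0 / E 2 0 v0 0 v0) + 1"
  let ?p0 = "(?pt 0 v0, ?pt 0 v0)"
  have lim: "((\<lambda>p. D i (fst p) (snd p)) \<longlongrightarrow> E i 0 v0 0 v0) (nhds ?p0)" for i
  proof -
    have "isCont (\<lambda>p. D i (fst p) (snd p)) ?p0"
      using cont[of i] continuous_on_eq_continuous_at open_UNIV by blast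
    then show ?thesis
      by (simp add: E_def isCont_def tendsto_nhds_iff)
  qed
  have "\<forall>\<^sub>F p in nhds ?p0. D 2 (fst p) (snd p) \<noteq> 0 \<and>
      norm (D 1 (fst p) (snd p) / D 2 (fst p) (snd p)) < C"
  proof (rule eventually_conj)
    show "\<forall>\<^sub>F p in nhds ?p0. D 2 (fst p) (snd p) \<noteq> 0"
      by (rule tendsto_imp_eventually_ne[OF lim E2])
    show "\<forall>\<^sub>F p in nhds ?p0. norm (D 1 (fst p) (snd p) / D 2 (fst p) (snd p)) < C"
      by (rule order_tendstoD(2)[OF tendsto_norm[OF tendsto_divide[OF lim lim E2]]]) (simp add: C_def)
  qed
  then obtain e where e: "0 < e"
    and near: "\<And>p. dist p ?p0 < e \<Longrightarrow> D 2 (fst p) (snd p) \<noteq> 0 \<and>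
      norm (D 1 (fst p) (snd p) / D 2 (fst p) (snd p)) < C"
    by (auto simp: eventually_nhds_metric)
  \<comment> \<open>The distance of a pair of points from \<open>?p0\<close> is at most a sum of
    four coordinate distances.\<close>
  define \<epsilon> where "\<epsilon> = e / 4"
  have near': "E 2 x v x' v' \<noteq> 0 \<and> norm (E 1 x v x' v' / E 2 x v x' v') < C"
    if "norm x < \<epsilon>" "dist v v0 < \<epsilon>" "norm x' < \<epsilon>" "dist v' v0 < \<epsilon>" for x v x' v'
  proof -
    have dist_pt: "dist (?pt y w) (?pt 0 v0) \<le> norm y + dist w v0" for y w
      using L2_set_le_sum[of UNIV "\<lambda>i. dist (?pt y w $ i) (?pt 0 v0 $ i)"]
      by (simp add: dist_vec_def sum_2)
    have "dist (?pt x v, ?pt x' v') ?p0 \<le> dist (?pt x v) (?pt 0 v0) + dist (?pt x' v') (?pt 0 v0)"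
      by (simp add: dist_Pair_Pair sqrt_sum_squares_le_sum)
    also have "\<dots> < e"
      using dist_pt[of x v] dist_pt[of x' v'] that by (simp add: \<epsilon>_def)
    finally show ?thesis
      using near[of "(?pt x v, ?pt x' v')"] by (simp add: E_def)
  qed
  show thesis
  proof (rule that[of \<epsilon>])
    show "0 < \<epsilon>"
      using e by (simp add: \<epsilon>_def)
  next
    fix \<psi> \<delta>
    assume \<delta>: "\<delta> \<le> \<epsilon>" and \<psi>: "\<And>x. norm x < \<delta> \<Longrightarrow> dist (\<psi> x) v0 < \<epsilon> \<and> f (?pt x (\<psi> x)) = 0"
    have "\<exists>D. (\<psi> has_field_derivative D) (at x')" if x': "norm x' < \<delta>" for x'
    proof -
      let ?E = "\<lambda>i x. E i x (\<psi> x) x' (\<psi> x')"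
      have ev: "\<forall>\<^sub>F x in at x'. norm x < \<delta>"
        using x' by (intro order_tendstoD(2)[OF tendsto_norm[OF tendsto_ident_at]])
      have diff: "\<psi> x - \<psi> x' = (x - x') * (- (?E 1 x / ?E 2 x))" and
        bound: "norm (?E 1 x / ?E 2 x) < C" if "norm x < \<delta>" for x
      proof -
        have *: "?E 2 x \<noteq> 0 \<and> norm (?E 1 x / ?E 2 x) < C"
          using that x' \<psi> \<delta> by (intro near') auto
        then show "norm (?E 1 x / ?E 2 x) < C" by blast
        have "(\<psi> x - \<psi> x') * ?E 2 x = - ((x - x') * ?E 1 x)"
          using E[of x "\<psi> x" x' "\<psi> x'"] \<psi>[OF that] \<psi>[OF x'] by (simp add: add_eq_0_iff)
        with * show "\<psi> x - \<psi> x' = (x - x') * (- (?E 1 x / ?E 2 x))"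
          by (simp add: field_simps)
      qed
      \<comment> \<open>Continuity of \<open>\<psi>\<close> is not assumed: the Lipschitz bound
        provides it, and only then does the difference quotient converge.\<close>
      have "(\<lambda>x. \<psi> x - \<psi> x') \<midarrow>x'\<rightarrow> 0"
      proof (rule Lim_null_comparison)
        show "\<forall>\<^sub>F x in at x'. norm (\<psi> x - \<psi> x') \<le> norm (x - x') * C"
          using ev
        proof eventually_elim
          case (elim x)
          show ?case
            unfolding diff[OF elim] norm_mult norm_minus_cancel
            using bound[OF elim] by (intro mult_left_mono) auto
        qed
        show "((\<lambda>x. norm (x - x') * C) \<longlongrightarrow> 0) (at x')"
          by (auto intro!: tendsto_eq_intros)
      qed
      then have "\<psi> \<midarrow>x'\<rightarrow> \<psi> x'"
        by (simp add: Lim_null[symmetric])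
      moreover have "E 2 x' (\<psi> x') x' (\<psi> x') \<noteq> 0"
        using near'[of x' "\<psi> x'" x' "\<psi> x'"] \<psi>[OF x'] x' \<delta> by simp
      ultimately have "(\<lambda>x. - (?E 1 x / ?E 2 x)) \<midarrow>x'\<rightarrow> - (?E 1 x' / ?E 2 x')"
        by (intro tendsto_minus tendsto_divide tendsto_E)
      then have "(\<psi> has_field_derivative - (?E 1 x' / ?E 2 x')) (at x')"
        unfolding has_field_derivative_iff
      proof (rule Lim_transform_eventually)
        have "\<forall>\<^sub>F x in at x'. x \<noteq> x'"
          by (simp add: eventually_at_filter)
        with ev show "\<forall>\<^sub>F x in at x'. - (?E 1 x / ?E 2 x) = (\<psi> x - \<psi> x') / (x - x')"
          by eventually_elim (simp add: diff del: times_divide_eq_right mult_minus_right)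
      qed
      then show ?thesis ..
    qed
    then show "\<psi> holomorphic_on ball 0 \<delta>"
      by (auto simp: holomorphic_on_open)
  qed
qed

section \<open>Degree and location of the roots of a univariate polynomial\<close>

lemma degree_eqI_reciprocal:
  fixes p q :: "complex poly"
  assumes eq: "\<And>u. u \<noteq> 0 \<Longrightarrow> poly q u = u ^ d * poly p (inverse u)" and "poly q 0 \<noteq> 0"
  shows "degree p = d" and "lead_coeff p = poly q 0"
proof -
  have q0: "coeff q 0 \<noteq> 0"
    using assms(2) by (simp add: poly_0_coeff_0)
  have "p \<noteq> 0"
  proof
    assume "p = 0"
    then have "q = 0"
      using eq by (intro poly_eqI_off_0) simp
    then show False
      using q0 by simp
  qed
  \<comment> \<open>Multiplying by powers of the variable avoids a negative exponent. The
    coefficient at \<open>d\<close> gives \<open>degree p \<le> d\<close>, the one at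
    \<open>degree p\<close> gives the converse.\<close>
  have *: "monom 1 (degree p) * q = monom 1 d * reflect_poly p"
    by (rule poly_eqI_off_0) (simp add: poly_monom eq poly_reflect_poly_nz)
  have "coeff (monom 1 (degree p) * q) d = lead_coeff p"
    unfolding * by (simp add: coeff_monom_mult)
  moreover have "coeff (monom 1 d * reflect_poly p) (degree p) = coeff q 0"
    unfolding *[symmetric] by (simp add: coeff_monom_mult)
  ultimately have "degree p \<le> d" and "d \<le> degree p"
    using \<open>p \<noteq> 0\<close> q0 by (auto simp: coeff_monom_mult split: if_splits)
  then show "degree p = d" by simp
  then show "lead_coeff p = poly q 0"
    using \<open>coeff (monom 1 (degree p) * q) d = lead_coeff p\<close>
    by (simp add: coeff_monom_mult poly_0_coeff_0)
qed

text \<open>\<open>p\<close> is its leading coefficient times the product of the differences to its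
  roots, and roots all at distance at least \<open>\<epsilon>\<close> would make that product too
  large.\<close>

lemma exists_root_near:
  fixes p :: "complex poly"
  assumes "p \<noteq> 0" and "0 \<le> \<epsilon>" and "norm (poly p v) < norm (lead_coeff p) * \<epsilon> ^ degree p"
  shows "\<exists>\<rho>. poly p \<rho> = 0 \<and> dist \<rho> v < \<epsilon>"
proof (rule ccontr)
  assume far: "\<nexists>\<rho>. poly p \<rho> = 0 \<and> dist \<rho> v < \<epsilon>"
  obtain A where A: "size A = degree p" "p = smult (lead_coeff p) (\<Prod>x\<in>#A. [:- x, 1:])"
    using alg_closed_imp_factorization[OF assms(1)] by blast
  have poly_p: "poly p w = lead_coeff p * (\<Prod>x\<in>#A. w - x)" for w
  proof -
    have "poly (\<Prod>x\<in>#A. [:- x, 1:]) w = (\<Prod>x\<in>#A. w - x)"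
      by (induction A) (simp_all add: left_diff_distrib)
    with arg_cong[OF A(2), of "\<lambda>p. poly p w"] show ?thesis
      by simp
  qed
  have "\<epsilon> \<le> norm (v - x)" if "x \<in># A" for x
  proof -
    have "poly p x = 0"
      using that by (simp add: poly_p prod_mset_zero_iff)
    with far show ?thesis
      by (metis dist_commute dist_norm not_less)
  qed
  then have "\<epsilon> ^ size A \<le> norm (\<Prod>x\<in>#A. v - x)"
    using assms(2) by (induction A) (auto simp: norm_mult intro!: mult_mono)
  then have "norm (lead_coeff p) * \<epsilon> ^ degree p \<le> norm (poly p v)"
    by (simp add: poly_p norm_mult A(1) mult_left_mono)
  with assms(3) show False by simp
qed

lemma analytic_on_poly: "poly (p :: complex poly) analytic_on S"
proof (induction p)
  case (pCons a p)
  have "poly (pCons a p) = (\<lambda>x. a + x * poly p x)" by auto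
  with pCons show ?case by (auto intro!: analytic_intros)
qed (simp add: zero_poly.rep_eq[symmetric] poly_0[abs_def])

section \<open>Branches of a separable form\<close>

context separable_form
begin

lemma continuous_in_parameter: "isCont (\<lambda>x. \<Psi> x u v) x0"
proof -
  obtain Q where "\<And>x y. \<Psi> x u y = bipoly Q x y"
    using polyn_3_bipoly[OF polyn, of u] by auto
  then show ?thesis
    by (simp add: bipoly_def)
qed

text \<open>By homogeneity the reversal of \<open>P x\<close> is
  \<open>\<lambda>u. \<Psi> x u 1\<close>, with constant term \<open>\<Psi> x 0 1\<close>; if that
  is nonzero, no root has escaped to infinity.\<close>

lemma dehomogenized_poly:
  obtains P where "\<And>x v. \<Psi> x 1 v = poly (P x) v"
    and "\<And>x. \<Psi> x 0 1 \<noteq> 0 \<Longrightarrow> degree (P x) = d"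
    and "\<And>x. \<Psi> x 0 1 \<noteq> 0 \<Longrightarrow> lead_coeff (P x) = \<Psi> x 0 1"
proof -
  obtain Q where Q: "\<And>x y. \<Psi> x 1 y = bipoly Q x y"
    using polyn_3_bipoly[OF polyn, of 1] by auto
  let ?P = "\<lambda>x. map_poly (\<lambda>c. poly c x) Q"
  have "degree (?P x) = d \<and> lead_coeff (?P x) = \<Psi> x 0 1" if "\<Psi> x 0 1 \<noteq> 0" for x
  proof -
    define q :: "3 \<Rightarrow> complex poly" where "q = (\<lambda>i. if i = 1 then [:x:] else if i = 2 then [:0, 1:] else 1)"
    obtain p where "\<And>u. \<Psi> ((\<chi> i. poly (q i) u) $ 1) ((\<chi> i. poly (q i) u) $ 2) ((\<chi> i. poly (q i) u) $ 3) = poly p u"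
      using polyn_on_curve[OF polyn, of q] by blast
    then have p: "\<Psi> x u 1 = poly p u" for u
      by (simp add: q_def)
    have "poly p u = u ^ d * poly (?P x) (inverse u)" if "u \<noteq> 0" for u
      using homogeneous[of x u 1 "inverse u"] that by (simp add: p Q bipoly_eq_poly)
    then show ?thesis
      using degree_eqI_reciprocal[of p d "?P x"] \<open>\<Psi> x 0 1 \<noteq> 0\<close> by (simp add: p)
  qed
  then show thesis
    by (intro that[of ?P]) (auto simp: Q bipoly_eq_poly)
qed

lemma card_slopes: "finite {v. \<Psi> 0 1 v = 0}" "card {v. \<Psi> 0 1 v = 0} = d"
proof -
  obtain P where P: "\<And>x v. \<Psi> x 1 v = poly (P x) v"
    and degree: "\<And>x. \<Psi> x 0 1 \<noteq> 0 \<Longrightarrow> degree (P x) = d"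
    by (rule dehomogenized_poly) blast
  have deg: "degree (P 0) = d"
    by (rule degree[OF nonvertical])
  have "P 0 \<noteq> 0"
    using deg d by auto
  then show "finite {v. \<Psi> 0 1 v = 0}"
    by (simp add: P poly_roots_finite)
  have "\<Psi> 0 1 = poly (P 0)"
    by (auto simp: P)
  then have "rsquarefree (P 0)"
    using separable by (auto simp: rsquarefree_roots deriv_poly)
  then have "degree (P 0) = degree (\<Prod>z|poly (P 0) z = 0. [:-z, 1:])"
    using complex_poly_decompose_rsquarefree[of "P 0"] \<open>P 0 \<noteq> 0\<close>
    by (metis degree_smult_eq leading_coeff_0_iff)
  also have "\<dots> = card {v. \<Psi> 0 1 v = 0}"
    by (subst degree_prod_eq_sum_degree) (auto simp: P)
  finally show "card {v. \<Psi> 0 1 v = 0} = d"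
    using deg by simp
qed

text \<open>Near each simple root of \<open>\<Psi> 0 1\<close> a root persists by
  \<open>exists_root_near\<close>. Disjoint discs keep these roots apart, the degree leaves room for
  no others, and simplicity makes any such choice holomorphic.\<close>

lemma analytic_roots:
  obtains \<psi> where "\<And>i. i < d \<Longrightarrow> \<psi> i analytic_on {0}"
    and "inj_on (\<lambda>i. \<psi> i 0) {..<d}"
    and "\<forall>\<^sub>F x in nhds 0. \<forall>v. \<Psi> x 1 v = 0 \<longleftrightarrow> (\<exists>i<d. v = \<psi> i x)"
proof -
  obtain P where P: "\<And>x v. \<Psi> x 1 v = poly (P x) v"
    and degree: "\<And>x. \<Psi> x 0 1 \<noteq> 0 \<Longrightarrow> degree (P x) = d"
    and lead: "\<And>x. \<Psi> x 0 1 \<noteq> 0 \<Longrightarrow> lead_coeff (P x) = \<Psi> x 0 1"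
    by (rule dehomogenized_poly) blast
  obtain r where r: "bij_betw r {..<d} {v. \<Psi> 0 1 v = 0}"
    using ex_bij_betw_nat_finite[OF card_slopes(1)] by (auto simp: card_slopes(2) atLeast0LessThan)
  have r_root: "\<Psi> 0 1 (r i) = 0" if "i < d" for i
    using r that by (auto simp: bij_betw_def)
  have r_inj: "r i \<noteq> r j" if "i < d" "j < d" "i \<noteq> j" for i j
    using r that by (auto simp: bij_betw_def inj_on_def)
  have f: "polyn (\<lambda>z :: complex ^ 2. \<Psi> (z $ 1) 1 (z $ 2))"
    by (intro polyn_compose_form polyn_intros)
  define good where "good i \<epsilon> \<longleftrightarrow>
      (\<forall>\<psi> \<delta>. \<delta> \<le> \<epsilon> \<longrightarrow> (\<forall>x. norm x < \<delta> \<longrightarrow> dist (\<psi> x) (r i) < \<epsilon> \<and> \<Psi> x 1 (\<psi> x) = 0) \<longrightarrow>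
        \<psi> holomorphic_on ball 0 \<delta>)" for i \<epsilon>
  have "\<exists>\<epsilon>>0. good i \<epsilon>" if "i < d" for i
  proof -
    have "deriv (\<lambda>v. \<Psi> ((vector [0, v] :: complex ^ 2) $ 1) 1 ((vector [0, v] :: complex ^ 2) $ 2)) (r i) \<noteq> 0"
      using separable[OF r_root[OF that]] by simp
    from simple_root_locally_holomorphic[OF f this] obtain \<epsilon> where "0 < \<epsilon>"
      and "\<And>\<psi> \<delta>. \<delta> \<le> \<epsilon> \<Longrightarrow> (\<And>x. norm x < \<delta> \<Longrightarrow> dist (\<psi> x) (r i) < \<epsilon> \<and> \<Psi> x 1 (\<psi> x) = 0) \<Longrightarrow>
        \<psi> holomorphic_on ball 0 \<delta>"
      unfolding vector_2 by blast
    then show ?thesis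
      by (intro exI[of _ \<epsilon>]) (simp add: good_def)
  qed
  then obtain E where E_pos: "\<And>i. i < d \<Longrightarrow> 0 < E i" and good: "\<And>i. i < d \<Longrightarrow> good i (E i)"
    by metis
  have holo: "\<psi> holomorphic_on ball 0 \<delta>"
    if "i < d" "\<delta> \<le> E i" "\<And>x. norm x < \<delta> \<Longrightarrow> dist (\<psi> x) (r i) < E i \<and> \<Psi> x 1 (\<psi> x) = 0" for i \<psi> \<delta>
    using good[OF that(1)] that(2,3) by (simp add: good_def)
  \<comment> \<open>The radius has to be admissible for holomorphy at every root and at most half
    the distance between any two roots.\<close>
  define S where "S = E ` {..<d} \<union> (\<lambda>(i, j). dist (r i) (r j) / 2) ` {(i, j). i < d \<and> j < d \<and> i \<noteq> j}"
  have "finite {(i, j). i < d \<and> j < d \<and> i \<noteq> j}"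
    by (rule finite_subset[of _ "{..<d} \<times> {..<d}"]) auto
  then have S: "finite S" "S \<noteq> {}"
    using d by (auto simp: S_def lessThan_empty_iff)
  define \<epsilon> where "\<epsilon> = Min S"
  have \<epsilon>: "0 < \<epsilon>"
    unfolding \<epsilon>_def using S E_pos r_inj by (subst Min_gr_iff) (auto simp: S_def)
  have \<epsilon>_E: "\<epsilon> \<le> E i" if "i < d" for i
    unfolding \<epsilon>_def using that by (intro Min_le S) (auto simp: S_def)
  have \<epsilon>_sep: "2 * \<epsilon> \<le> dist (r i) (r j)" if "i < d" "j < d" "i \<noteq> j" for i j
  proof -
    have "\<epsilon> \<le> dist (r i) (r j) / 2"
      unfolding \<epsilon>_def using that by (intro Min_le S) (auto simp: S_def)
    then show ?thesis by simp
  qed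
  have "\<forall>\<^sub>F x in nhds 0. norm (\<Psi> x 1 (r i)) < norm (\<Psi> x 0 1) * \<epsilon> ^ d" if "i < d" for i
  proof -
    have "isCont (\<lambda>x. norm (\<Psi> x 0 1) * \<epsilon> ^ d - norm (\<Psi> x 1 (r i))) 0"
      by (intro continuous_intros continuous_in_parameter)
    then have "((\<lambda>x. norm (\<Psi> x 0 1) * \<epsilon> ^ d - norm (\<Psi> x 1 (r i))) \<longlongrightarrow> norm (\<Psi> 0 0 1) * \<epsilon> ^ d) (nhds 0)"
      using r_root[OF that] by (simp add: isCont_def tendsto_nhds_iff)
    from order_tendstoD(1)[OF this, of 0] show ?thesis
      using nonvertical \<epsilon> by simp
  qed
  then have "\<forall>\<^sub>F x in nhds 0. \<forall>i\<in>{..<d}. norm (\<Psi> x 1 (r i)) < norm (\<Psi> x 0 1) * \<epsilon> ^ d"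
    by (intro eventually_ball_finite) auto
  then obtain \<delta>0 where \<delta>0: "0 < \<delta>0"
    and small: "\<And>x i. norm x < \<delta>0 \<Longrightarrow> i < d \<Longrightarrow> norm (\<Psi> x 1 (r i)) < norm (\<Psi> x 0 1) * \<epsilon> ^ d"
    by (auto simp: eventually_nhds_metric)
  define \<delta> where "\<delta> = min \<delta>0 \<epsilon>"
  \<comment> \<open>The strict inequality \<open>small\<close> forces its right-hand side to be
    positive; \<open>d \<ge> 2\<close> provides the index 0.\<close>
  have lead_nonzero: "\<Psi> x 0 1 \<noteq> 0" if "norm x < \<delta>" for x
    using small[of x 0] that d by (auto simp: \<delta>_def)
  have ex_root: "\<exists>v. \<Psi> x 1 v = 0 \<and> dist v (r i) < \<epsilon>" if x: "norm x < \<delta>" and i: "i < d" for x i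
  proof -
    have "P x \<noteq> 0"
      using degree[OF lead_nonzero[OF x]] d by auto
    then show ?thesis
      using exists_root_near[of "P x" \<epsilon> "r i"] small[of x i] x i \<epsilon>
        degree[OF lead_nonzero[OF x]] lead[OF lead_nonzero[OF x]]
      by (auto simp: P \<delta>_def)
  qed
  \<comment> \<open>An arbitrary choice for each \<open>x\<close> separately; \<open>holo\<close>
    supplies the regularity.\<close>
  define \<psi> where "\<psi> i x = (SOME v. \<Psi> x 1 v = 0 \<and> dist v (r i) < \<epsilon>)" for i x
  have root: "\<Psi> x 1 (\<psi> i x) = 0" and near: "dist (\<psi> i x) (r i) < \<epsilon>" if "i < d" "norm x < \<delta>" for i x
    using someI_ex[OF ex_root[OF that(2,1)]] by (simp_all add: \<psi>_def)
  have \<delta>: "0 < \<delta>"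
    using \<delta>0 \<epsilon> by (simp add: \<delta>_def)
  have inj: "\<psi> i x \<noteq> \<psi> j x" if "i < d" "j < d" "i \<noteq> j" "norm x < \<delta>" for i j x
  proof
    assume "\<psi> i x = \<psi> j x"
    then have "dist (r i) (r j) < \<epsilon> + \<epsilon>"
      using dist_triangle_lt[of "r i" "\<psi> i x" "r j"] near[of i x] near[of j x] that
        dist_triangle3[of "r i" "r j" "\<psi> i x"] by auto
    then show False
      using \<epsilon>_sep[OF that(1-3)] by simp
  qed
  show thesis
  proof (rule that[of \<psi>])
    fix i assume i: "i < d"
    have "\<psi> i holomorphic_on ball 0 \<delta>"
    proof (rule holo[OF i])
      show "\<delta> \<le> E i"
        using \<epsilon>_E[OF i] by (simp add: \<delta>_def)
      show "dist (\<psi> i x) (r i) < E i \<and> \<Psi> x 1 (\<psi> i x) = 0" if "norm x < \<delta>" for x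
        using less_le_trans[OF near[OF i that] \<epsilon>_E[OF i]] root[OF i that] by (rule conjI)
    qed
    then show "\<psi> i analytic_on {0}"
      using \<delta> by (auto simp: analytic_at intro!: exI[of _ "ball 0 \<delta>"])
  next
    show "inj_on (\<lambda>i. \<psi> i 0) {..<d}"
      using inj[of _ _ 0] \<delta> by (auto simp: inj_on_def)
  next
    show "\<forall>\<^sub>F x in nhds 0. \<forall>v. \<Psi> x 1 v = 0 \<longleftrightarrow> (\<exists>i<d. v = \<psi> i x)"
    proof -
      \<comment> \<open>The \<open>d\<close> chosen roots are distinct, and a polynomial of degree
        \<open>d\<close> has no more.\<close>
      have "{v. \<Psi> x 1 v = 0} = (\<lambda>i. \<psi> i x) ` {..<d}" if x: "norm x < \<delta>" for x
      proof -
        have "P x \<noteq> 0"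
          using degree[OF lead_nonzero[OF x]] d by auto
        then have "finite {v. \<Psi> x 1 v = 0}" "card {v. \<Psi> x 1 v = 0} \<le> d"
          using card_poly_roots_bound[of "P x"] degree[OF lead_nonzero[OF x]] poly_roots_finite
          by (auto simp: P)
        moreover have "card ((\<lambda>i. \<psi> i x) ` {..<d}) = d"
          using inj[of _ _ x] x by (subst card_image) (auto simp: inj_on_def)
        moreover have "(\<lambda>i. \<psi> i x) ` {..<d} \<subseteq> {v. \<Psi> x 1 v = 0}"
          using root x by auto
        ultimately show ?thesis
          using card_seteq by metis
      qed
      then show ?thesis
        unfolding eventually_nhds_metric using \<delta> by (intro exI[of _ \<delta>]) (auto simp: set_eq_iff)
    qed
  qed
qed

text \<open>In the Leibniz formula only the \<open>k\<close>-th derivative of \<open>x^k\<close>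
  survives at 0. Below order \<open>k\<close> all branches share the jet of \<open>- r\<close>; the
  value \<open>\<psi> 0\<close> enters exactly at order \<open>k\<close>.\<close>

lemma higher_deriv_contact_branch:
  assumes "\<psi> analytic_on {0}" and "m \<le> k"
  shows "(deriv ^^ m) (\<lambda>x. x ^ k * \<psi> x - poly r x) 0 =
    (if m = k then fact k * \<psi> 0 else 0) - (deriv ^^ m) (poly r) 0"
proof -
  have power: "(\<lambda>x. x ^ k) = poly (monom (1 :: complex) k)"
    by (auto simp: poly_monom)
  have "(deriv ^^ m) (\<lambda>x. x ^ k * \<psi> x) 0 =
      (\<Sum>j = 0..m. of_nat (m choose j) * (deriv ^^ j) (\<lambda>x. x ^ k) 0 * (deriv ^^ (m - j)) \<psi> 0)"
    by (rule higher_deriv_mult_at) (auto simp: power analytic_on_poly assms)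
  also have "\<dots> = (\<Sum>j = 0..m. if j = k then fact k * \<psi> 0 else 0)"
    using assms(2) by (intro sum.cong) (auto simp: power higher_deriv_poly_0)
  also have "\<dots> = (if m = k then fact k * \<psi> 0 else 0)"
    using assms(2) by simp
  finally show ?thesis
    using assms(1)
    by (subst higher_deriv_diff_at) (auto simp: power analytic_on_poly intro!: analytic_intros)
qed

text \<open>Off \<open>x = 0\<close>, dividing the last two arguments by \<open>x^k\<close> leads to
  the equation solved by \<open>analytic_roots\<close>. On \<open>x = 0\<close> the equation is a
  nonzero multiple of \<open>y^d\<close>, so only the origin remains.\<close>

lemma branches_contact:
  assumes "invertible L" and f: "\<And>z. f (L *v z) = \<Psi> (z $ 1) (z $ 1 ^ k) (z $ 2 + poly r (z $ 1))"
    and r: "poly r 0 = 0" and k: "1 \<le> k"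
  shows "\<exists>\<phi>. branches f d L \<phi> \<and> agree_to_order d \<phi> (k - 1) \<and> \<not> agree_to_order d \<phi> k"
proof -
  obtain \<psi> where analytic: "\<And>i. i < d \<Longrightarrow> \<psi> i analytic_on {0}"
    and inj: "inj_on (\<lambda>i. \<psi> i 0) {..<d}"
    and roots: "\<forall>\<^sub>F x in nhds 0. \<forall>v. \<Psi> x 1 v = 0 \<longleftrightarrow> (\<exists>i<d. v = \<psi> i x)"
    by (rule analytic_roots) blast
  define \<phi> where "\<phi> i x = x ^ k * \<psi> i x - poly r x" for i x
  have higher_deriv: "(deriv ^^ m) (\<phi> i) 0 = (if m = k then fact k * \<psi> i 0 else 0) - (deriv ^^ m) (poly r) 0"
    if "i < d" "m \<le> k" for i m
    unfolding \<phi>_def[abs_def] by (rule higher_deriv_contact_branch[OF analytic[OF that(1)] that(2)])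
  \<comment> \<open>Used twice: the germs of the branches differ, and their contact fails at order
    \<open>k\<close>.\<close>
  have distinct: "(deriv ^^ k) (\<phi> i) 0 \<noteq> (deriv ^^ k) (\<phi> j) 0" if "i < d" "j < d" "i \<noteq> j" for i j
    using that inj by (auto simp: higher_deriv inj_on_def)
  have "((\<lambda>z :: complex ^ 2. z $ 1) \<longlongrightarrow> 0) (nhds 0)"
    by (auto simp: tendsto_nhds_iff intro!: tendsto_eq_intros)
  from eventually_compose_filterlim[OF roots this]
  have "\<forall>\<^sub>F z :: complex ^ 2 in nhds 0. f (L *v z) = 0 \<longleftrightarrow> (\<exists>i<d. z $ 2 = \<phi> i (z $ 1))"
  proof eventually_elim
    case (elim z)
    let ?x = "z $ 1" and ?y = "z $ 2 + poly r (z $ 1)"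
    show ?case
    proof (cases "?x = 0")
      case True
      then show ?thesis
        using r k d nonvertical vertical_eq[of "z $ 2"]
          by (auto simp: f \<phi>_def power_0_left intro: exI[of _ 0])
    next
      case False
      have "f (L *v z) = (?x ^ k) ^ d * \<Psi> ?x 1 (?y / ?x ^ k)"
        using homogeneous[of ?x "?x ^ k" 1 "?y / ?x ^ k"] False by (simp add: f)
      then have "f (L *v z) = 0 \<longleftrightarrow> (\<exists>i<d. ?y / ?x ^ k = \<psi> i ?x)"
        using elim False by simp
      also have "\<dots> \<longleftrightarrow> (\<exists>i<d. z $ 2 = \<phi> i ?x)"
        using False by (auto simp: \<phi>_def field_simps)
      finally show ?thesis .
    qed
  qed
  moreover have "\<phi> i analytic_on {0}" if "i < d" for i
    unfolding \<phi>_def[abs_def] using analytic[OF that] by (auto intro!: analytic_intros analytic_on_poly)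
  moreover have "\<not> (\<forall>\<^sub>F x in nhds 0. \<phi> i x = \<phi> j x)" if "i < d" "j < d" "i \<noteq> j" for i j
    using distinct[OF that] higher_deriv_cong_ev by blast
  ultimately have "branches f d L \<phi>"
    using assms(1) r k by (auto simp: branches_def \<phi>_def)
  moreover have "agree_to_order d \<phi> (k - 1)"
    using k by (auto simp: agree_to_order_def higher_deriv)
  moreover have "\<not> agree_to_order d \<phi> k"
  proof
    assume "agree_to_order d \<phi> k"
    then have "(deriv ^^ k) (\<phi> 0) 0 = (deriv ^^ k) (\<phi> 1) 0"
      using d unfolding agree_to_order_def by (elim allE[of _ 0] allE[of _ 1] allE[of _ k] impE) simp_all
    then show False
      using distinct[of 0 1] d by simp
  qed
  ultimately show ?thesis by blast
qed

end

section \<open>The equation of the constructed curve\<close>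

lemma matrix_inv_left: "invertible M \<Longrightarrow> matrix_inv M ** M = mat 1"
  and matrix_inv_right: "invertible M \<Longrightarrow> M ** matrix_inv M = mat 1"
  for M :: "complex ^ 'n ^ 'm"
  unfolding atomize_imp atomize_conj invertible_def matrix_inv_def
  using someI_ex[of "\<lambda>M'. M ** M' = mat 1 \<and> M' ** M = mat 1"] by blast

lemma matrix_inv_mult_vector: "invertible M \<Longrightarrow> matrix_inv M *v (M *v z) = z"
  and mult_matrix_inv_vector: "invertible M \<Longrightarrow> M *v (matrix_inv M *v z) = z"
  for M :: "complex ^ 'n ^ 'n"
  by (simp_all add: matrix_vector_mul_assoc matrix_inv_left matrix_inv_right)

lemma polyn_linear: "polyn f \<Longrightarrow> polyn (\<lambda>z. f (M *v z))"
  by (erule polyn_compose) (auto simp: matrix_vector_mult_def intro!: polyn_intros)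

lemma vector_4:
  "(vector [a, b, c, d] :: complex ^ 4) $ 1 = a" "(vector [a, b, c, d] :: complex ^ 4) $ 2 = b"
  "(vector [a, b, c, d] :: complex ^ 4) $ 3 = c" "(vector [a, b, c, d] :: complex ^ 4) $ 4 = d"
  by (simp_all add: vector_def)

lemma vector_5:
  "(vector [a, b, c, d, e] :: complex ^ 5) $ 1 = a" "(vector [a, b, c, d, e] :: complex ^ 5) $ 2 = b"
  "(vector [a, b, c, d, e] :: complex ^ 5) $ 3 = c" "(vector [a, b, c, d, e] :: complex ^ 5) $ 4 = d"
  "(vector [a, b, c, d, e] :: complex ^ 5) $ 5 = e"
  by (simp_all add: vector_def)

lemma vector_4_eta: "(vector [z $ 1, z $ 2, z $ 3, z $ 4] :: complex ^ 4) = z"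
  by (simp add: vec_eq_iff forall_4 vector_4)

lemma polyn_first_up: "polyn f \<Longrightarrow> polyn (\<lambda>z. f (first_up z))"
  by (erule polyn_compose, unfold atomize_all, rule forall_4[THEN iffD2])
    (simp add: first_up_def vector_4 polyn_intros)

lemma polyn_second_up: "polyn f \<Longrightarrow> polyn (\<lambda>z. f (second_up k c z))"
  by (erule polyn_compose, unfold atomize_all, rule forall_4[THEN iffD2])
    (simp add: second_up_def vector_4 polyn_intros)

text \<open>In an elementary transformation whose center lies outside the curve the first proper transform
  is the total transform. Restricting the second one to the chart in which the equation of the
  contracted curve is 1 recovers the new equation, whatever the multiplicity.\<close>

lemma elementary_first_eq:
  assumes "elementary_first k f f'" and center: "f (vector [0, x, y, 0]) \<noteq> 0"
  shows "f' z = f (vector [z $ 1, z $ 2, z $ 3, z $ 1 * z $ 4])"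
proof -
  obtain g where f: "polyn f" and g: "proper_transform first_up (\<lambda>z. z $ 5) f g"
    and f': "proper_transform first_down (\<lambda>z. z $ 1) f' g"
    using assms(1) by (auto simp: elementary_first_def hirz_curve_def)
  have "proper_transform first_up (\<lambda>z. z $ 5) f g \<longleftrightarrow> g = (\<lambda>z. f (first_up z))"
    by (rule proper_transform_iff[where M = 0, OF polyn_first_up[OF f]])
      (use center in \<open>auto simp: first_up_def vector_5 intro!: exI[of _ "vector [0, x, y, 0, 0]"]\<close>)
  with g have "g = (\<lambda>z. f (first_up z))" by simp
  then obtain m where "\<And>z. f' (first_down z) = (z $ 1) ^ m * f (first_up z)"
    using f' by (auto simp: proper_transform_def)
  from this[of "vector [1, z $ 2, z $ 3, z $ 4, z $ 1]"] show ?thesis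
    by (simp add: first_down_def first_up_def vector_5 vector_4_eta)
qed

lemma elementary_second_eq:
  assumes "elementary_second k c f f'" and center: "f (vector [1, 0, c, 1]) \<noteq> 0"
  shows "f' z = f (vector [z $ 1, z $ 2, z $ 2 * z $ 3 + c * z $ 1 ^ k * z $ 4, z $ 4])"
proof -
  obtain g where f: "polyn f" and g: "proper_transform (second_up k c) (\<lambda>z. z $ 5) f g"
    and f': "proper_transform second_down (\<lambda>z. z $ 2) f' g"
    using assms(1) by (auto simp: elementary_second_def hirz_curve_def)
  have "proper_transform (second_up k c) (\<lambda>z. z $ 5) f g \<longleftrightarrow> g = (\<lambda>z. f (second_up k c z))"
    by (rule proper_transform_iff[where M = 0, OF polyn_second_up[OF f]])
      (use center in \<open>auto simp: second_up_def vector_5 intro!: exI[of _ "vector [1, 0, 0, 1, 0]"]\<close>)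
  with g have "g = (\<lambda>z. f (second_up k c z))" by simp
  then obtain m where "\<And>z. f' (second_down z) = (z $ 2) ^ m * f (second_up k c z)"
    using f' by (auto simp: proper_transform_def)
  from this[of "vector [z $ 1, 1, z $ 3, z $ 4, z $ 2]"] show ?thesis
    by (simp add: second_down_def second_up_def vector_5 vector_4_eta)
qed

text \<open>The exponent \<open>n + 1 - j\<close> is the index of the Hirzebruch surface carrying
  the \<open>j\<close>-th center of the second type.\<close>

definition uludag_map :: "nat \<Rightarrow> (nat \<Rightarrow> complex) \<Rightarrow> complex ^ 3 \<Rightarrow> complex ^ 3" where
  "uludag_map n c w = vector [w $ 1 ^ (n + 1), w $ 1 ^ n * w $ 2,
     w $ 2 ^ n * w $ 3 + (\<Sum>j<n. c j * w $ 1 ^ (n + 1 - j) * w $ 2 ^ j)]"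

lemma uludag_equation:
  assumes C: "polyn C" and "1 \<le> n" and "uludag_construction n C C'"
  obtains A B c where "invertible A" "invertible B"
    and "transversal_line C (A $ 1)" "transversal_line C (A $ 2)"
    and "C (matrix_inv A *v vector [0, 0, 1]) \<noteq> 0" "C (matrix_inv A *v vector [1, 0, c 0]) \<noteq> 0"
    and "C' = (\<lambda>z. C (matrix_inv A *v uludag_map n c (B *v z)))"
proof -
  from assms(3) obtain Q P R A B f g c where Q: "transversal_line C Q" and P: "transversal_line C P"
    and outside: "\<forall>p. p \<noteq> 0 \<and> on_line Q p \<and> on_line P p \<longrightarrow> C p \<noteq> 0"
    and A: "A = vector [Q, P, R]" "invertible A" and B: "invertible B"
    and start: "proper_transform (contract_section A) (\<lambda>z. z $ 4) C (f 0)"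
    and firsts: "\<forall>i<n. elementary_first (i + 1) (f i) (f (i + 1))"
    and g0: "g 0 = f n"
    and seconds: "\<forall>i<n. g i (vector [1, 0, c i, 1]) \<noteq> 0 \<and>
               elementary_second (n + 1 - i) (c i) (g i) (g (i + 1))"
    and final: "proper_transform (contract_section B) (\<lambda>z. z $ 4) C' (g n)"
    unfolding uludag_construction_def by (elim exE conjE)
  have first: "elementary_first (i + 1) (f i) (f (i + 1))"
    and center: "g i (vector [1, 0, c i, 1]) \<noteq> 0"
    and second: "elementary_second (n + 1 - i) (c i) (g i) (g (i + 1))" if "i < n" for i
    using firsts seconds that by blast+
  define F where "F w = C (matrix_inv A *v w)" for w
  have F: "polyn F"
    unfolding F_def[abs_def] by (rule polyn_linear[OF C])
  \<comment> \<open>\<open>?p\<close> is the intersection point of \<open>Q\<close> and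
    \<open>P\<close>, which lies outside the curve.\<close>
  have F_point: "F (vector [0, 0, 1]) \<noteq> 0"
  proof -
    let ?p = "matrix_inv A *v vector [0, 0, 1]"
    have "A *v ?p = vector [0, 0, 1]"
      by (rule mult_matrix_inv_vector[OF A(2)])
    then have p: "(A *v ?p) $ 1 = 0" "(A *v ?p) $ 2 = 0" "(A *v ?p) $ 3 = 1"
      by simp_all
    have "on_line Q ?p" "on_line P ?p"
      using p(1,2) unfolding matrix_vector_mult_def A(1) by (simp_all add: on_line_def)
    moreover have "?p \<noteq> 0"
      using p(3) by (metis matrix_vector_mult_0_right zero_index zero_neq_one)
    ultimately show ?thesis
      using outside by (simp add: F_def)
  qed
  have f: "f i = (\<lambda>z. F (vector [z $ 1 ^ (i + 1) * z $ 4, z $ 1 ^ i * z $ 2 * z $ 4, z $ 3]))" if "i \<le> n" for i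
    using that
  proof (induction i)
    case 0
    have "f 0 = (\<lambda>z. F (vector [z $ 1 * z $ 4, z $ 2 * z $ 4, z $ 3]))"
      using start F_point
      by (subst (asm) proper_transform_iff[where M = 0 and h = "\<lambda>z. F (vector [z $ 1 * z $ 4, z $ 2 * z $ 4, z $ 3])"])
        (auto simp: F_def contract_section_def vector_4 intro!: polyn_vector_3 polyn_linear C polyn_intros
          exI[of _ "vector [0, 0, 1, 0]"])
    then show ?case by simp
  next
    case (Suc i)
    have *: "f i = (\<lambda>z. F (vector [z $ 1 ^ (i + 1) * z $ 4, z $ 1 ^ i * z $ 2 * z $ 4, z $ 3]))"
      using Suc by simp
    \<comment> \<open>The center lies on the exceptional section, where every \<open>f i\<close>
      takes the value of \<open>F\<close> at the blown-up point.\<close>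
    have "f i (vector [0, 0, 1, 0]) \<noteq> 0"
      using F_point by (simp add: * vector_4)
    then have "f (i + 1) z = f i (vector [z $ 1, z $ 2, z $ 3, z $ 1 * z $ 4])" for z
      using Suc.prems by (intro elementary_first_eq[OF first]) auto
    then show ?case
      by (simp add: * vector_4 fun_eq_iff mult_ac)
  qed
  have g: "g i = (\<lambda>z. F (vector [z $ 1 ^ (n + 1) * z $ 4, z $ 1 ^ n * z $ 2 * z $ 4,
      z $ 2 ^ i * z $ 3 + (\<Sum>j<i. c j * z $ 1 ^ (n + 1 - j) * z $ 2 ^ j) * z $ 4]))" if "i \<le> n" for i
    using that
  proof (induction i)
    case 0
    then show ?case by (simp add: g0 f)
  next
    case (Suc i)
    have *: "g i = (\<lambda>z. F (vector [z $ 1 ^ (n + 1) * z $ 4, z $ 1 ^ n * z $ 2 * z $ 4,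
        z $ 2 ^ i * z $ 3 + (\<Sum>j<i. c j * z $ 1 ^ (n + 1 - j) * z $ 2 ^ j) * z $ 4]))"
      using Suc by simp
    have "g (i + 1) z = g i (vector [z $ 1, z $ 2, z $ 2 * z $ 3 + c i * z $ 1 ^ (n + 1 - i) * z $ 4, z $ 4])" for z
      using Suc.prems by (intro elementary_second_eq second center) auto
    then show ?case
      by (simp add: * vector_4 fun_eq_iff algebra_simps)
  qed
  obtain m where m: "\<And>z. C' (contract_section B z) = (z $ 4) ^ m * g n z"
    using final by (auto simp: proper_transform_def)
  have "C' z = F (uludag_map n c (B *v z))" for z
  proof -
    let ?w = "B *v z"
    \<comment> \<open>Off the exceptional section one can normalize \<open>y\<^sub>1 = 1\<close>, so
      the unknown power \<open>m\<close> disappears.\<close>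
    have "C' (contract_section B (vector [?w $ 1, ?w $ 2, ?w $ 3, 1])) = F (uludag_map n c ?w)"
      by (simp add: m g vector_4 uludag_map_def mult_ac)
    then show ?thesis
      by (simp add: contract_section_def vector_4 matrix_inv_mult_vector[OF B])
  qed
  moreover have "F (vector [1, 0, c 0]) \<noteq> 0"
    using center[of 0] assms(2) by (simp add: g vector_4)
  moreover have "A $ 1 = Q" "A $ 2 = P"
    by (simp_all add: A(1))
  ultimately show thesis
    using A(2) B Q P F_point by (intro that[of A B c]) (simp_all add: F_def fun_eq_iff)
qed

section \<open>The singular points of the constructed curve\<close>

lemma gradient_compose:
  assumes "polyn F" and \<Phi>: "\<And>j. polyn (\<lambda>w. \<Phi> w $ j)"
  shows "gradient (\<lambda>w. F (\<Phi> w)) w $ i =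
    (\<Sum>j\<in>UNIV. gradient F (\<Phi> w) $ j * gradient (\<lambda>w. \<Phi> w $ j) w $ i)"
proof -
  let ?l = "\<lambda>t. w + t *s axis i 1"
  have "((\<lambda>t. ?l t $ j) has_field_derivative axis i 1 $ j) (at 0)" for j
    by (auto intro!: derivative_eq_intros simp: axis_def)
  then have "((\<lambda>t. \<Phi> (?l t) $ j) has_field_derivative gradient (\<lambda>w. \<Phi> w $ j) w $ i) (at 0)" for j
    using has_field_derivative_polyn[OF \<Phi>[of j], of ?l "\<lambda>j. axis i 1 $ j" 0] by (simp add: sum_axis_right)
  from has_field_derivative_polyn[OF assms(1) this] show ?thesis
    by (subst (1) gradient_def) (simp add: DERIV_imp_deriv)
qed

lemma gradient_linear_eq_0:
  assumes "polyn F" and "gradient F (M *v p) = 0"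
  shows "gradient (\<lambda>z. F (M *v z)) p = 0"
proof -
  have "polyn (\<lambda>z. (M *v z) $ j)" for j
    by (rule polyn_linear[OF polyn.coord])
  from gradient_compose[OF assms(1) this] assms(2) show ?thesis
    by (simp add: vec_eq_iff)
qed

lemma gradient_linear:
  assumes "polyn F"
  shows "gradient (\<lambda>z. F (M *v z)) p = (\<Sum>j\<in>UNIV. gradient F (M *v p) $ j *s M $ j)"
proof -
  have "gradient (\<lambda>z. (M *v z) $ j) p $ i = M $ j $ i" for i j
  proof -
    have "(M *v (p + t *s axis i 1)) $ j = (M *v p) $ j + t * M $ j $ i" for t
    proof -
      have "(M *v (p + t *s axis i 1)) $ j = (M *v p) $ j + t * (\<Sum>k\<in>UNIV. M $ j $ k * axis i 1 $ k)"
        by (simp add: matrix_vector_mult_def distrib_left sum.distrib sum_distrib_left mult.left_commute)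
      then show ?thesis
        by (simp add: sum_axis_right)
    qed
    then show ?thesis
      unfolding gradient_def by (auto intro!: DERIV_imp_deriv derivative_eq_intros)
  qed
  moreover have "polyn (\<lambda>z. (M *v z) $ j)" for j
    by (rule polyn_linear[OF polyn.coord])
  ultimately show ?thesis
    using gradient_compose[OF assms, of "\<lambda>z. M *v z" p] by (simp add: vec_eq_iff)
qed

lemma det_linear_images:
  fixes N :: "complex ^ 3 ^ 3"
  shows "det (vector [N *v x, N *v y, N *v z] :: complex ^ 3 ^ 3) = det N * det (vector [x, y, z] :: complex ^ 3 ^ 3)"
proof -
  have "(vector [N *v x, N *v y, N *v z] :: complex ^ 3 ^ 3) = vector [x, y, z] ** transpose N"
    by (simp add: vec_eq_iff forall_3 matrix_matrix_mult_def matrix_vector_mult_def transpose_def mult.commute)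
  then show ?thesis
    by (simp add: det_mul det_transpose)
qed

text \<open>The initial curve in coordinates where \<open>Q\<close> and \<open>P\<close> are
  \<open>w $ 1 = 0\<close> and \<open>w $ 2 = 0\<close>. Transversality says that the gradient is
  not a multiple of the corresponding axis vector; the two centers are the point common to
  \<open>Q\<close> and \<open>P\<close>, and the first center of the second type, seen on
  \<open>P\<close>.\<close>

locale smooth_form =
  fixes F :: "complex ^ 3 \<Rightarrow> complex" and d n :: nat and c :: "nat \<Rightarrow> complex"
  assumes F: "polyn F"
    and homogeneous: "F (t *s w) = t ^ d * F w"
    and smooth: "w \<noteq> 0 \<Longrightarrow> F w = 0 \<Longrightarrow> gradient F w \<noteq> 0"
    and transversal_1: "w \<noteq> 0 \<Longrightarrow> F w = 0 \<Longrightarrow> w $ 1 = 0 \<Longrightarrow> gradient F w $ 2 \<noteq> 0 \<or> gradient F w $ 3 \<noteq> 0"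
    and transversal_2: "w \<noteq> 0 \<Longrightarrow> F w = 0 \<Longrightarrow> w $ 2 = 0 \<Longrightarrow> gradient F w $ 1 \<noteq> 0 \<or> gradient F w $ 3 \<noteq> 0"
    and center_1: "F (vector [0, 0, 1]) \<noteq> 0"
    and center_2: "F (vector [1, 0, c 0]) \<noteq> 0"
    and n: "1 \<le> n"
begin

text \<open>Euler's relation on the curve, where the degree term vanishes. Combined with
  transversality it yields a nonzero derivative along the line.\<close>

lemma euler: "F w = 0 \<Longrightarrow> gradient F w $ 1 * w $ 1 + gradient F w $ 2 * w $ 2 + gradient F w $ 3 * w $ 3 = 0"
proof -
  assume "F w = 0"
  then have "(\<lambda>t. F (t *s w)) = (\<lambda>t. 0)"
    by (simp add: homogeneous)
  moreover have "((\<lambda>t. F (t *s w)) has_field_derivative (\<Sum>i\<in>UNIV. gradient F (1 *s w) $ i * w $ i)) (at 1)"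
    by (rule has_field_derivative_polyn[OF F]) (auto intro!: derivative_eq_intros)
  ultimately show ?thesis
    using DERIV_unique[OF _ DERIV_const] by (fastforce simp: sum_3)
qed

lemma homogeneous_vector: "F (vector [t * x, t * y, t * z]) = t ^ d * F (vector [x, y, z])"
proof -
  have "(vector [t * x, t * y, t * z] :: complex ^ 3) = t *s vector [x, y, z]"
    by (simp add: vec_eq_iff forall_3)
  then show ?thesis by (simp add: homogeneous)
qed

lemma deriv_line:
  "deriv (\<lambda>v. F (vector [a + v * a', b + v * b', e + v * e'])) v =
    gradient F (vector [a + v * a', b + v * b', e + v * e']) $ 1 * a' +
    gradient F (vector [a + v * a', b + v * b', e + v * e']) $ 2 * b' +
    gradient F (vector [a + v * a', b + v * b', e + v * e']) $ 3 * e'"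
proof -
  let ?\<gamma> = "\<lambda>v. vector [a + v * a', b + v * b', e + v * e'] :: complex ^ 3"
  have "\<forall>i. ((\<lambda>v. ?\<gamma> v $ i) has_field_derivative (vector [a', b', e'] :: complex ^ 3) $ i) (at v)"
    unfolding forall_3 by (auto intro!: derivative_eq_intros)
  from DERIV_imp_deriv[OF has_field_derivative_polyn[OF F this[rule_format]]] show ?thesis
    by (simp add: sum_3)
qed

abbreviation (input) "H \<equiv> \<lambda>w. F (uludag_map n c w)"

lemma polyn_uludag_map: "polyn (\<lambda>w. uludag_map n c w $ j)"
proof -
  have "\<forall>j. polyn (\<lambda>w. uludag_map n c w $ j)"
    unfolding forall_3 uludag_map_def vector_3 by (intro conjI polyn_intros)
  then show ?thesis ..
qed

lemma polyn_H: "polyn H"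
  by (rule polyn_compose[OF F polyn_uludag_map])

lemma vanishing_form: "F (vector [0, 0, v]) = v ^ d * F (vector [0, 0, 1])"
  using homogeneous_vector[of v 0 0 1] by simp

lemma H_homogeneous: "H (t *s w) = t ^ (d * (n + 1)) * H w"
proof -
  have "(\<Sum>j<n. c j * (t * w $ 1) ^ (n + 1 - j) * (t * w $ 2) ^ j) =
      (\<Sum>j<n. t ^ (n + 1) * (c j * w $ 1 ^ (n + 1 - j) * w $ 2 ^ j))"
  proof (rule sum.cong[OF refl])
    fix j assume "j \<in> {..<n}"
    then have "t ^ (n + 1) = t ^ (n + 1 - j) * t ^ j"
      by (simp flip: power_add)
    then show "c j * (t * w $ 1) ^ (n + 1 - j) * (t * w $ 2) ^ j = t ^ (n + 1) * (c j * w $ 1 ^ (n + 1 - j) * w $ 2 ^ j)"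
      by (simp add: power_mult_distrib)
  qed
  then have "uludag_map n c (t *s w) = t ^ (n + 1) *s uludag_map n c w"
    by (simp add: uludag_map_def vec_eq_iff forall_3 power_mult_distrib sum_distrib_left algebra_simps)
  then have "H (t *s w) = (t ^ (n + 1)) ^ d * H w"
    by (simp only: homogeneous)
  then show ?thesis
    by (simp only: power_mult mult.commute[of d])
qed

text \<open>The point is sent to \<open>(0, 0, 1)\<close>, off the curve; this excludes a zero
  equation.\<close>

lemma H_nonzero: "H (vector [0, 1, 1]) \<noteq> 0"
proof -
  have "(\<Sum>j<n. c j * 0 ^ (n + 1 - j) * 1 ^ j) = (0 :: complex)"
    by (intro sum.neutral) auto
  then show ?thesis
    using center_1 n by (simp add: uludag_map_def power_0_left)
qed

lemma H_singular_imp: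
  assumes "H w = 0" and "gradient H w = 0"
  shows "w $ 1 = 0 \<and> (w $ 2 = 0 \<or> w $ 3 = 0)"
proof (cases "w $ 1 = 0")
  case True
  then have "(\<Sum>j<n. c j * w $ 1 ^ (n + 1 - j) * w $ 2 ^ j) = 0"
    by (intro sum.neutral) auto
  then have "H w = F (vector [0, 0, w $ 2 ^ n * w $ 3])"
    using True n by (simp add: uludag_map_def power_0_left)
  then have "w $ 2 ^ n * w $ 3 = 0"
    using assms(1) vanishing_form[of "w $ 2 ^ n * w $ 3"] center_1 by auto
  with True show ?thesis by auto
next
  case False
  \<comment> \<open>Off \<open>w $ 1 = 0\<close>, the line \<open>w $ 2 = 0\<close> is contracted to
    the point \<open>(1 : 0 : c 0)\<close>, which is off the curve.\<close>
  have "w $ 2 \<noteq> 0"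
  proof
    assume w2: "w $ 2 = 0"
    have "(\<Sum>j<n. c j * w $ 1 ^ (n + 1 - j) * w $ 2 ^ j) = (\<Sum>j<n. if j = 0 then c 0 * w $ 1 ^ (n + 1) else 0)"
      by (intro sum.cong) (auto simp: w2 power_0_left)
    then have "uludag_map n c w = vector [w $ 1 ^ (n + 1) * 1, w $ 1 ^ (n + 1) * 0, w $ 1 ^ (n + 1) * c 0]"
      using n by (simp add: uludag_map_def w2 power_0_left mult_ac)
    then have "H w = (w $ 1 ^ (n + 1)) ^ d * F (vector [1, 0, c 0])"
      by (simp only: homogeneous_vector)
    then show False
      using assms(1) False center_2 by simp
  qed
  \<comment> \<open>The Jacobian matrix is lower triangular with diagonal
    \<open>(n + 1) x^n\<close>, \<open>x^n\<close>, \<open>y^n\<close>; the chain rule equations are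
    solved from the last one upwards.\<close>
  let ?J = "\<lambda>j i. gradient (\<lambda>w. uludag_map n c w $ j) w $ i" and ?g = "gradient F (uludag_map n c w)"
  have axis: "axis 1 1 $ (2 :: 3) = (0 :: complex)" "axis 1 1 $ (3 :: 3) = (0 :: complex)"
    "axis 2 1 $ (1 :: 3) = (0 :: complex)" "axis 2 1 $ (3 :: 3) = (0 :: complex)"
    "axis 3 1 $ (1 :: 3) = (0 :: complex)" "axis 3 1 $ (2 :: 3) = (0 :: complex)"
    "axis i 1 $ (i :: 3) = (1 :: complex)" for i
    by (auto simp: axis_def)
  have "?J 1 1 = of_nat (n + 1) * w $ 1 ^ n"
    unfolding gradient_def uludag_map_def
    by (simp add: axis del: power_Suc, rule DERIV_imp_deriv)
      (use n in \<open>auto intro!: derivative_eq_intros simp: power_minus_mult[unfolded One_nat_def] mult.assoc distrib_right\<close>)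
  moreover have "?J 2 2 = w $ 1 ^ n"
    unfolding gradient_def uludag_map_def
    by (simp add: axis; rule DERIV_imp_deriv; auto intro!: derivative_eq_intros)
  moreover have "?J 3 3 = w $ 2 ^ n"
    unfolding gradient_def uludag_map_def
    by (simp add: axis; rule DERIV_imp_deriv; auto intro!: derivative_eq_intros)
  moreover have "?J 1 2 = 0" "?J 1 3 = 0" "?J 2 3 = 0"
    unfolding gradient_def uludag_map_def by (simp_all add: axis)
  moreover have "(\<Sum>j\<in>UNIV. ?g $ j * ?J j i) = 0" for i
    using gradient_compose[OF F polyn_uludag_map, of w i] assms(2) by simp
  from this[of 1] this[of 2] this[of 3]
  have "?g $ 1 * ?J 1 1 + ?g $ 2 * ?J 2 1 + ?g $ 3 * ?J 3 1 = 0"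
    "?g $ 1 * ?J 1 2 + ?g $ 2 * ?J 2 2 + ?g $ 3 * ?J 3 2 = 0"
    "?g $ 1 * ?J 1 3 + ?g $ 2 * ?J 2 3 + ?g $ 3 * ?J 3 3 = 0"
    by (simp_all add: sum_3)
  ultimately have "?g $ 3 = 0 \<and> ?g $ 2 = 0 \<and> ?g $ 1 = 0"
    using False \<open>w $ 2 \<noteq> 0\<close> n
    by (simp add: sum_3 del: of_nat_Suc)
  then have "?g = 0"
    by (simp add: vec_eq_iff forall_3)
  moreover have "uludag_map n c w \<noteq> 0"
    using False by (auto simp: uludag_map_def vec_eq_iff forall_3)
  ultimately show ?thesis
    using smooth assms(1) by blast
qed

text \<open>Where the map takes the zero vector as value, \<open>F\<close> has a zero of order at
  least 2 on each axis line, so its gradient is zero there.\<close>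

lemma H_singularI:
  assumes "2 \<le> d" and "uludag_map n c w = 0"
  shows "H w = 0" and "gradient H w = 0"
proof -
  show "H w = 0"
    using homogeneous[of 0 0] assms by (simp add: power_0_left)
  have "gradient F 0 $ i = 0" for i
  proof -
    have "F (0 + t *s axis i 1) = t ^ d * F (axis i 1)" for t
      by (simp add: homogeneous)
    moreover have "((\<lambda>t. t ^ d * F (axis i 1)) has_field_derivative 0) (at 0)"
      using assms(1) by (auto intro!: derivative_eq_intros simp: power_0_left)
    ultimately show ?thesis
      by (simp add: gradient_def DERIV_imp_deriv)
  qed
  then show "gradient H w = 0"
    using gradient_compose[OF F polyn_uludag_map, of w] assms(2) by (simp add: vec_eq_iff)
qed

lemma uludag_map_center_1: "uludag_map n c (vector [0, 1, 0]) = 0"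
proof -
  have "(\<Sum>j<n. c j * 0 ^ (n + 1 - j) * 1 ^ j) = (0 :: complex)"
    by (intro sum.neutral) auto
  then show ?thesis
    using n by (simp add: uludag_map_def vec_eq_iff forall_3 power_0_left)
qed

lemma uludag_map_center_2: "uludag_map n c (vector [0, 0, 1]) = 0"
proof -
  have "(\<Sum>j<n. c j * 0 ^ (n + 1 - j) * 0 ^ j) = (0 :: complex)"
    by (intro sum.neutral) auto
  then show ?thesis
    using n by (simp add: uludag_map_def vec_eq_iff forall_3 power_0_left)
qed

section \<open>Local equations at the two singular points\<close>

lemma H_at_center_1:
  "H (vector [x, 1, y]) =
    F (vector [x * x ^ n, x ^ n, y + poly (\<Sum>j<n. monom (c j) (n + 1 - j)) x])"
  by (simp add: uludag_map_def poly_sum poly_monom)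

text \<open>At \<open>x = 0\<close> this is the equation of the curve on \<open>Q\<close>. At
  \<open>(0, 1, v)\<close> Euler's relation reads \<open>g_2 + v g_3 = 0\<close>, so
  \<open>g_3 = 0\<close> would force \<open>g_2 = 0\<close>, against transversality.\<close>

lemma separable_form_center_1:
  assumes "2 \<le> d"
  shows "separable_form (\<lambda>x u v. F (vector [x * u, u, v])) d"
proof
  show "polyn (\<lambda>z :: complex ^ 3. F (vector [z $ 1 * z $ 2, z $ 2, z $ 3]))"
    by (intro polyn_vector_3[OF F] polyn_intros)
  show "F (vector [x * (t * u), t * u, t * v]) = t ^ d * F (vector [x * u, u, v])" for x t u v
    by (simp add: homogeneous_vector[symmetric] mult_ac)
  show "F (vector [0 * 0, 0, 1]) \<noteq> 0"
    using center_1 by simp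
next
  fix v
  assume "F (vector [0 * 1, 1, v]) = 0"
  then have v: "F (vector [0, 1, v]) = 0" by simp
  moreover have "(vector [0, 1, v] :: complex ^ 3) \<noteq> 0"
    by (simp add: vec_eq_iff forall_3)
  ultimately show "deriv (\<lambda>v. F (vector [0 * 1, 1, v])) v \<noteq> 0"
    using transversal_1[of "vector [0, 1, v]"] euler[OF v] deriv_line[of 0 0 1 0 0 1 v] by auto
qed (fact assms)

text \<open>For \<open>n = 1\<close> the curve at its second singular point is a form in \<open>x\<^sup>2\<close> and \<open>y + c 0 * x\<^sup>2\<close>.\<close>

lemma separable_form_center_2_1:
  assumes "2 \<le> d"
  shows "separable_form (\<lambda>x u v. F (vector [u, x * (v - c 0 * u), v])) d"
proof
  show "polyn (\<lambda>z :: complex ^ 3. F (vector [z $ 2, z $ 1 * (z $ 3 - c 0 * z $ 2), z $ 3]))"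
    by (intro polyn_vector_3[OF F] polyn_intros)
  show "F (vector [t * u, x * (t * v - c 0 * (t * u)), t * v]) = t ^ d * F (vector [u, x * (v - c 0 * u), v])"
    for x t u v
    unfolding homogeneous_vector[symmetric] by (simp add: right_diff_distrib mult_ac)
  show "F (vector [0, 0 * (1 - c 0 * 0), 1]) \<noteq> 0"
    using center_1 by simp
next
  fix v
  assume "F (vector [1, 0 * (v - c 0 * 1), v]) = 0"
  then have v: "F (vector [1, 0, v]) = 0" by simp
  moreover have "(vector [1, 0, v] :: complex ^ 3) \<noteq> 0"
    by (simp add: vec_eq_iff forall_3)
  ultimately show "deriv (\<lambda>v. F (vector [1, 0 * (v - c 0 * 1), v])) v \<noteq> 0"
    using transversal_2[of "vector [1, 0, v]"] euler[OF v] deriv_line[of 1 0 0 0 0 1 v] by auto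
qed (fact assms)

text \<open>At \<open>x = 0\<close> this is the equation of the curve on \<open>P\<close>, in
  coordinates whose vertical direction is the center \<open>(1 : 0 : c 0)\<close>.\<close>

lemma separable_form_center_2:
  assumes "2 \<le> d"
  shows "separable_form (\<lambda>x u v. F (vector [v, v * x, u + v * (\<Sum>j<n. c j * x ^ j)])) d"
proof
  show "polyn (\<lambda>z :: complex ^ 3. F (vector [z $ 3, z $ 3 * z $ 1, z $ 2 + z $ 3 * (\<Sum>j<n. c j * z $ 1 ^ j)]))"
    by (intro polyn_vector_3[OF F] polyn_intros)
  show "F (vector [t * v, t * v * x, t * u + t * v * (\<Sum>j<n. c j * x ^ j)]) =
      t ^ d * F (vector [v, v * x, u + v * (\<Sum>j<n. c j * x ^ j)])" for x t u v
    unfolding homogeneous_vector[symmetric] by (simp add: distrib_left mult.assoc)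
  have "(\<Sum>j<n. c j * 0 ^ j) = (\<Sum>j<n. if j = 0 then c 0 else 0)"
    by (intro sum.cong) (auto simp: power_0_left)
  then have c0: "(\<Sum>j<n. c j * 0 ^ j) = c 0"
    using n by simp
  show "F (vector [1, 1 * 0, 0 + 1 * (\<Sum>j<n. c j * 0 ^ j)]) \<noteq> 0"
    unfolding c0 using center_2 by simp
  fix v
  assume "F (vector [v, v * 0, 1 + v * (\<Sum>j<n. c j * 0 ^ j)]) = 0"
  then have v: "F (vector [v, 0, 1 + v * c 0]) = 0"
    unfolding c0 by simp
  let ?g = "gradient F (vector [v, 0, 1 + v * c 0])"
  have "(vector [v, 0, 1 + v * c 0] :: complex ^ 3) \<noteq> 0"
    by (auto simp: vec_eq_iff forall_3)
  then have "?g $ 1 \<noteq> 0 \<or> ?g $ 3 \<noteq> 0"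
    using transversal_2 v by simp
  moreover have "v * (?g $ 1 + c 0 * ?g $ 3) + ?g $ 3 = 0"
    using euler[OF v] by (simp add: algebra_simps)
  ultimately have "?g $ 1 + c 0 * ?g $ 3 \<noteq> 0"
    by (metis add_0 add_cancel_right_right mult_zero_right)
  then show "deriv (\<lambda>v. F (vector [v, v * 0, 1 + v * (\<Sum>j<n. c j * 0 ^ j)])) v \<noteq> 0"
    unfolding c0 using deriv_line[of 0 1 0 0 1 "c 0" v] by (simp add: mult.commute)
qed (fact assms)

lemma center_1_singularity:
  assumes "2 \<le> d"
  shows "singularity_type (\<lambda>z. H (vector [z $ 1, 1, z $ 2])) (replicate n d)"
    and "\<exists>L \<phi>. branches (\<lambda>z. H (vector [z $ 1, 1, z $ 2])) d L \<phi> \<and>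
      agree_to_order d \<phi> (n - 1) \<and> \<not> agree_to_order d \<phi> n"
proof -
  interpret separable_form "\<lambda>x u v. F (vector [x * u, u, v])" d
    by (rule separable_form_center_1[OF assms])
  have r: "poly (\<Sum>j<n. monom (c j) (n + 1 - j)) 0 = 0"
    by (auto simp: poly_sum poly_monom intro!: sum.neutral)
  show "singularity_type (\<lambda>z. H (vector [z $ 1, 1, z $ 2])) (replicate n d)"
    unfolding H_at_center_1 by (rule singularity_type_contact[OF r n])
  have "\<exists>\<phi>. branches (\<lambda>z. H (vector [z $ 1, 1, z $ 2])) d (mat 1) \<phi> \<and>
      agree_to_order d \<phi> (n - 1) \<and> \<not> agree_to_order d \<phi> n"
    by (rule branches_contact[OF _ _ r n])
      (auto simp: invertible_def H_at_center_1 intro!: exI[of _ "mat 1"])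
  then show "\<exists>L \<phi>. branches (\<lambda>z. H (vector [z $ 1, 1, z $ 2])) d L \<phi> \<and>
      agree_to_order d \<phi> (n - 1) \<and> \<not> agree_to_order d \<phi> n"
    by blast
qed

lemma center_2_singularity_1:
  assumes "2 \<le> d" and "n = 1"
  shows "singularity_type (\<lambda>z. H (vector [z $ 1, z $ 2, 1])) [d, d]"
    and "tacnode (\<lambda>z. H (vector [z $ 1, z $ 2, 1])) d"
proof -
  interpret separable_form "\<lambda>x u v. F (vector [u, x * (v - c 0 * u), v])" d
    by (rule separable_form_center_2_1[OF assms(1)])
  have r: "poly (monom (c 0) 2) 0 = 0"
    by (simp add: poly_monom)
  \<comment> \<open>The middle entry is \<open>x * y\<close>, rewritten through
    \<open>u = x^2\<close> and \<open>v = y + c 0 * x^2\<close> to make it linear in them. The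
    contact exponent is therefore 2.\<close>
  have H_eq: "H (vector [x, y, 1]) =
      F (vector [x ^ 2, x * (y + poly (monom (c 0) 2) x - c 0 * x ^ 2), y + poly (monom (c 0) 2) x])" for x y
    by (simp add: uludag_map_def assms(2) poly_monom power2_eq_square)
  have "singularity_type (\<lambda>z. H (vector [z $ 1, z $ 2, 1])) (replicate 2 d)"
    unfolding H_eq by (rule singularity_type_contact[OF r]) simp
  then show "singularity_type (\<lambda>z. H (vector [z $ 1, z $ 2, 1])) [d, d]"
    by (simp add: numeral_2_eq_2 del: singularity_type.simps)
  have "\<exists>\<phi>. branches (\<lambda>z. H (vector [z $ 1, z $ 2, 1])) d (mat 1) \<phi> \<and>
      agree_to_order d \<phi> (2 - 1) \<and> \<not> agree_to_order d \<phi> 2"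
    by (rule branches_contact[OF _ _ r])
      (auto simp: invertible_def H_eq intro!: exI[of _ "mat 1"])
  then show "tacnode (\<lambda>z. H (vector [z $ 1, z $ 2, 1])) d"
    using assms(1) by (auto simp: tacnode_def)
qed

text \<open>All entries of the map are divisible by \<open>t^n\<close> along \<open>t *s w\<close>,
  and the quotient at \<open>t = 0\<close> is \<open>(0, 0, y^n)\<close>. This gives multiplicity
  \<open>d * n\<close> and a single tangent direction.\<close>

lemma center_2_singularity:
  assumes "2 \<le> d" and "2 \<le> n"
  shows "singularity_type (\<lambda>z. H (vector [z $ 1, z $ 2, 1])) (d * n # replicate n d)"
    and "blow_down_of_tacnode (\<lambda>z. H (vector [z $ 1, z $ 2, 1])) d (n - 1)"
proof -
  interpret separable_form "\<lambda>x u v. F (vector [v, v * x, u + v * (\<Sum>j<n. c j * x ^ j)])" d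
    by (rule separable_form_center_2[OF assms(1)])
  define q where "q x y = (\<Sum>j<n. c j * x ^ (n + 1 - j) * y ^ j)" for x y
  have q: "q (t * x) (t * y) = t ^ n * (t * q x y)" for t x y
  proof -
    have "c j * (t * x) ^ (n + 1 - j) * (t * y) ^ j = t ^ n * (t * (c j * x ^ (n + 1 - j) * y ^ j))" if "j < n" for j
    proof -
      have "t ^ n * t = t ^ (n + 1 - j) * t ^ j"
        using that by (simp flip: power_add power_Suc2)
      then show ?thesis
        by (simp add: power_mult_distrib mult_ac)
    qed
    then show ?thesis
      unfolding q_def sum_distrib_left by (intro sum.cong refl) (simp only: lessThan_iff)
  qed
  let ?f = "\<lambda>z :: complex ^ 2. H (vector [z $ 1, z $ 2, 1])"
  define h where "h t w = F (vector [t * w $ 1 ^ (n + 1), t * (w $ 1 ^ n * w $ 2), w $ 2 ^ n + t * q (w $ 1) (w $ 2)])"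
    for t and w :: "complex ^ 2"
  have h_0: "h 0 w = w $ 2 ^ (d * n) * F (vector [0, 0, 1])" for w
    by (simp add: h_def vanishing_form[of "w $ 2 ^ n"] mult.commute flip: power_mult)
  have exp: "initial_expansion (d * n) ?f h"
    unfolding initial_expansion_def
  proof (intro conjI allI)
    fix t and w :: "complex ^ 2"
    have "?f (t *s w) = F (vector [t ^ n * (t * w $ 1 ^ (n + 1)), t ^ n * (t * (w $ 1 ^ n * w $ 2)),
        t ^ n * (w $ 2 ^ n + t * q (w $ 1) (w $ 2))])"
      using q[of t "w $ 1" "w $ 2"]
      by (simp add: uludag_map_def q_def power_mult_distrib distrib_left mult_ac)
    then show "?f (t *s w) = t ^ (d * n) * h t w"
      by (simp only: homogeneous_vector h_def mult.commute[of d] power_mult)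
  next
    fix b
    have "h 0 (direction None 0) \<noteq> 0" "h 0 (direction (Some a) (1 - a)) \<noteq> 0" for a
      using center_1 by (simp_all add: h_0 direction_def)
    then show "\<exists>s. h 0 (direction b s) \<noteq> 0"
      by (cases b) blast+
  next
    show "polyn ?f"
      by (rule polyn_vector_3[OF polyn_H]) (intro polyn_intros)+
    show "polyn (\<lambda>z :: complex ^ 3. h (z $ 1) (vector [z $ 2, z $ 3]))"
      unfolding h_def q_def vector_2 by (intro polyn_vector_3[OF F] polyn_intros)
  qed
  \<comment> \<open>The chart of slope 0. There the branches are graphs over the second coordinate
    and are tangent to the exceptional line, which calls for the swapped contact lemma and the
    permutation \<open>?L\<close>.\<close>
  let ?g = "\<lambda>z :: complex ^ 2. h (z $ 1) (direction (Some 0) (z $ 2))"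
  have g: "?g z = F (vector [z $ 1, z $ 1 * z $ 2, z $ 2 ^ n + z $ 1 * (\<Sum>j<n. c j * z $ 2 ^ j)])" for z
    by (simp add: h_def q_def direction_def)
  \<comment> \<open>The transform avoids every other point of the exceptional line, as both
    conclusions require.\<close>
  have other: "h 0 (direction b 0) \<noteq> 0" if "b \<noteq> Some 0" for b
    using that center_1 by (cases b) (auto simp: h_0 direction_def)
  have "singularity_type ?g (replicate n d)"
    unfolding g by (rule singularity_type_contact_swapped[OF assms(2)])
  moreover have "1 < d * n"
    using mult_le_mono[OF assms] by simp
  moreover have "mult0 (\<lambda>z. h (z $ 1) (direction b (z $ 2))) \<le> 1" if "b \<noteq> Some 0" for b
    using other[OF that] by (intro mult0_le_1I) simp
  ultimately show "singularity_type ?f (d * n # replicate n d)"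
    using singularity_type_ConsI[OF exp] by blast
  let ?L = "vector [vector [0, 1], vector [1, 0]] :: complex ^ 2 ^ 2"
  have L: "?L *v z = vector [z $ 2, z $ 1]" for z
    by (simp add: vec_eq_iff forall_2 matrix_vector_mult_def sum_2)
  have "?L ** ?L = mat 1"
    by (simp add: vec_eq_iff forall_2 matrix_matrix_mult_def sum_2 mat_def)
  then have "invertible ?L"
    by (auto simp: invertible_def)
  then have "\<exists>\<phi>. branches ?g d ?L \<phi> \<and> agree_to_order d \<phi> (n - 1) \<and> \<not> agree_to_order d \<phi> n"
    by (rule branches_contact[where r = 0, OF _ _ _ n])
      (simp_all add: L h_def q_def direction_def)
  then have "tacnode_of_order ?g d (n - 1)"
    using assms by (auto simp: tacnode_of_order_def)
  then show "blow_down_of_tacnode ?f d (n - 1)"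
    unfolding blow_down_of_tacnode_def local_transform_iff[OF exp] using other by auto
qed

end

section \<open>Passage between the given and the adapted coordinates\<close>

lemma smooth_form_coordinates:
  fixes A :: "complex ^ 3 ^ 3"
  assumes C: "plane_curve d C" "singular_points C = {}" and A: "invertible A"
    and lines: "transversal_line C (A $ 1)" "transversal_line C (A $ 2)"
    and centers: "C (matrix_inv A *v vector [0, 0, 1]) \<noteq> 0" "C (matrix_inv A *v vector [1, 0, c 0]) \<noteq> 0"
    and n: "1 \<le> n"
  shows "smooth_form (\<lambda>w. C (matrix_inv A *v w)) d n c"
proof -
  define F where "F w = C (matrix_inv A *v w)" for w
  have polyn_C: "polyn C"
    using C by (simp add: plane_curve_def)
  have F: "polyn F"
    unfolding F_def[abs_def] by (rule polyn_linear[OF polyn_C])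
  have C_eq: "C = (\<lambda>z. F (A *v z))"
    by (simp add: F_def matrix_inv_mult_vector[OF A])
  have grad: "gradient C p = (\<Sum>j\<in>UNIV. gradient F (A *v p) $ j *s A $ j)" for p
    unfolding C_eq by (rule gradient_linear[OF F])
  have point: "A *v (matrix_inv A *v w) = w" "w \<noteq> 0 \<Longrightarrow> matrix_inv A *v w \<noteq> 0" for w
    using mult_matrix_inv_vector[OF A] by (auto, metis matrix_vector_mult_0_right)
  have on_line: "on_line (A $ j) (matrix_inv A *v w) \<longleftrightarrow> w $ j = 0" for j w
    using arg_cong[OF point(1)[of w], of "\<lambda>w. w $ j"]
    by (simp add: on_line_def matrix_vector_mult_def)
  have transversal: "\<exists>i. i \<noteq> j \<and> gradient F w $ i \<noteq> 0"
    if "transversal_line C (A $ j)" "w \<noteq> 0" "F w = 0" "w $ j = 0" for j w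
  proof (rule ccontr)
    assume "\<nexists>i. i \<noteq> j \<and> gradient F w $ i \<noteq> 0"
    \<comment> \<open>The gradient of \<open>C\<close> combines the rows of \<open>A\<close> with
      the partial derivatives of \<open>F\<close>; if only the \<open>j\<close>-th is nonzero, it is
      a multiple of the line \<open>A $ j\<close>.\<close>
    then have "(\<Sum>i\<in>UNIV. gradient F w $ i *s A $ i) = gradient F w $ j *s A $ j"
      by (subst sum.remove[of _ j]) (auto intro!: sum.neutral)
    then have "gradient C (matrix_inv A *v w) = gradient F w $ j *s A $ j"
      by (simp add: grad point(1))
    moreover have "on_line (A $ j) (matrix_inv A *v w)"
      using that(4) by (simp add: on_line)
    ultimately show False
      using that(1-3) point(2) unfolding transversal_line_def F_def by blast
  qed
  have "smooth_form F d n c"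
  proof
    show "F (t *s w) = t ^ d * F w" for t w
      using C(1) by (simp add: F_def plane_curve_def vector_scalar_commute)
    show "gradient F w \<noteq> 0" if "w \<noteq> 0" "F w = 0" for w
    proof
      assume "gradient F w = 0"
      then have "gradient C (matrix_inv A *v w) = 0"
        by (simp add: grad point(1))
      then have "proj_pt (matrix_inv A *v w) \<in> singular_points C"
        using that point(2) unfolding singular_points_def F_def by blast
      then show False
        using C(2) by simp
    qed
    show "gradient F w $ 2 \<noteq> 0 \<or> gradient F w $ 3 \<noteq> 0" if "w \<noteq> 0" "F w = 0" "w $ 1 = 0" for w
      using transversal[OF lines(1) that] by (metis exhaust_3)
    show "gradient F w $ 1 \<noteq> 0 \<or> gradient F w $ 3 \<noteq> 0" if "w \<noteq> 0" "F w = 0" "w $ 2 = 0" for w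
      using transversal[OF lines(2) that] by (metis exhaust_3)
  qed (use centers n F in \<open>auto simp: F_def\<close>)
  then show ?thesis
    by (simp add: F_def[abs_def])
qed

lemma local_equation_linear:
  fixes B :: "complex ^ 3 ^ 3"
  assumes B: "invertible B" and "det (vector [x, y, z] :: complex ^ 3 ^ 3) \<noteq> 0"
  shows "local_equation (\<lambda>p. G (B *v p)) (matrix_inv B *v x) (\<lambda>w. G (x + w $ 1 *s y + w $ 2 *s z))"
  unfolding local_equation_def
proof (intro exI conjI)
  have "det (matrix_inv B) * det B = 1"
    using matrix_inv_left[OF B] by (metis det_I det_mul)
  then show "det (vector [matrix_inv B *v x, matrix_inv B *v y, matrix_inv B *v z] :: complex ^ 3 ^ 3) \<noteq> 0"
    using assms(2) by (auto simp: det_linear_images)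
  show "(\<lambda>w. G (x + w $ 1 *s y + w $ 2 *s z)) =
      (\<lambda>w. G (B *v (matrix_inv B *v x + w $ 1 *s (matrix_inv B *v y) + w $ 2 *s (matrix_inv B *v z))))"
    by (simp add: matrix_vector_right_distrib vector_scalar_commute mult_matrix_inv_vector[OF B])
qed

lemma singular_points_linear:
  fixes B :: "complex ^ 3 ^ 3"
  assumes "polyn G" and B: "invertible B"
  shows "singular_points (\<lambda>p. G (B *v p)) =
    {proj_pt (matrix_inv B *v w) |w. w \<noteq> 0 \<and> G w = 0 \<and> gradient G w = 0}"
proof -
  have G_eq: "G = (\<lambda>w. (\<lambda>p. G (B *v p)) (matrix_inv B *v w))"
    by (simp add: mult_matrix_inv_vector[OF B])
  have polyn: "polyn (\<lambda>p. G (B *v p))"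
    by (rule polyn_linear[OF assms(1)])
  \<comment> \<open>The converse implication is the chain rule applied to the inverse
    matrix.\<close>
  have "gradient G (B *v p) = 0" if "gradient (\<lambda>p. G (B *v p)) p = 0" for p
    using gradient_linear_eq_0[OF polyn, of "matrix_inv B" "B *v p"] that
    by (simp add: matrix_inv_mult_vector[OF B] mult_matrix_inv_vector[OF B])
  then have grad: "gradient (\<lambda>p. G (B *v p)) p = 0 \<longleftrightarrow> gradient G (B *v p) = 0" for p
    using gradient_linear_eq_0[OF assms(1)] by blast
  have zero: "B *v p = 0 \<longleftrightarrow> p = 0" for p
    by (metis matrix_inv_mult_vector[OF B] matrix_vector_mult_0_right)
  show ?thesis
    unfolding singular_points_def grad
  proof (intro set_eqI iffI; elim CollectE exE conjE)
    fix X p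
    assume "X = proj_pt p" "p \<noteq> 0" "G (B *v p) = 0" "gradient G (B *v p) = 0"
    then show "X \<in> {proj_pt (matrix_inv B *v w) |w. w \<noteq> 0 \<and> G w = 0 \<and> gradient G w = 0}"
      by (auto intro!: exI[of _ "B *v p"] simp: matrix_inv_mult_vector[OF B] zero)
  next
    fix X w
    assume "X = proj_pt (matrix_inv B *v w)" "w \<noteq> 0" "G w = 0" "gradient G w = 0"
    then show "X \<in> {proj_pt p |p. p \<noteq> 0 \<and> G (B *v p) = 0 \<and> gradient G (B *v p) = 0}"
      using zero[of "matrix_inv B *v w"]
      by (auto intro!: exI[of _ "matrix_inv B *v w"] simp: mult_matrix_inv_vector[OF B])
  qed
qed

lemma proj_pt_scale: "t \<noteq> 0 \<Longrightarrow> proj_pt (t *s p) = proj_pt p"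
proof -
  assume t: "t \<noteq> 0"
  show ?thesis
  proof (intro set_eqI iffI)
    show "x \<in> proj_pt p" if "x \<in> proj_pt (t *s p)" for x
      using that by (auto simp: proj_pt_def vector_smult_assoc)
    show "x \<in> proj_pt (t *s p)" if "x \<in> proj_pt p" for x
    proof -
      from that obtain c where "x = c *s p"
        by (auto simp: proj_pt_def)
      then have "x = (c / t) *s (t *s p)"
        using t by (simp add: vector_smult_assoc)
      then show ?thesis
        unfolding proj_pt_def by (rule range_eqI)
    qed
  qed
qed

theorem proposition5p7:
  fixes C C' :: "complex ^ 3 \<Rightarrow> complex" and d n :: nat
  assumes "plane_curve d C" and "irreducible_polyn C" and "singular_points C = {}"
    and "n \<ge> 1"
    and "uludag_construction n C C'"
  shows "plane_curve (d * (n + 1)) C' \<and>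
    (d \<ge> 2 \<longrightarrow>
      (\<exists>a b f g. a \<noteq> 0 \<and> b \<noteq> 0 \<and> proj_pt a \<noteq> proj_pt b \<and>
         singular_points C' = {proj_pt a, proj_pt b} \<and>
         local_equation C' a f \<and> local_equation C' b g \<and>
         (n = 1 \<longrightarrow>
            smooth_branches_point f d \<and> singularity_type f [d] \<and>
            tacnode g d \<and> singularity_type g [d, d]) \<and>
         (n \<ge> 2 \<longrightarrow>
            tacnode_of_order f d (n - 1) \<and> singularity_type f (replicate n d) \<and>
            blow_down_of_tacnode g d (n - 1) \<and> singularity_type g (d * n # replicate n d))))"
proof -
  have "polyn C"
    using assms(1) by (simp add: plane_curve_def)
  then obtain A B c where A: "invertible A" and B: "invertible B"
    and lines: "transversal_line C (A $ 1)" "transversal_line C (A $ 2)"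
    and centers: "C (matrix_inv A *v vector [0, 0, 1]) \<noteq> 0" "C (matrix_inv A *v vector [1, 0, c 0]) \<noteq> 0"
    and C': "C' = (\<lambda>z. C (matrix_inv A *v uludag_map n c (B *v z)))"
    using uludag_equation assms(4,5) by blast
  define F where "F w = C (matrix_inv A *v w)" for w
  interpret smooth_form F d n c
    unfolding F_def[abs_def] by (rule smooth_form_coordinates[where C = C and A = A and c = c, OF assms(1,3) A lines centers assms(4)])
  define G where "G w = F (uludag_map n c w)" for w
  have C'_eq: "C' = (\<lambda>z. G (B *v z))"
    by (simp add: C' G_def F_def)
  have polyn_G: "polyn G"
    unfolding G_def[abs_def] by (rule polyn_H)
  have "plane_curve (d * (n + 1)) C'"
    unfolding plane_curve_def
  proof (intro conjI allI)
    show "polyn C'"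
      unfolding C'_eq by (rule polyn_linear[OF polyn_G])
    have "C' (matrix_inv B *v vector [0, 1, 1]) \<noteq> 0"
      using H_nonzero by (simp add: C'_eq G_def mult_matrix_inv_vector[OF B])
    then show "C' \<noteq> (\<lambda>z. 0)" by auto
    show "C' (t *s z) = t ^ (d * (n + 1)) * C' z" for t z
      using H_homogeneous by (simp only: C'_eq G_def vector_scalar_commute)
  qed
  moreover have "\<exists>a b f g. a \<noteq> 0 \<and> b \<noteq> 0 \<and> proj_pt a \<noteq> proj_pt b \<and>
         singular_points C' = {proj_pt a, proj_pt b} \<and>
         local_equation C' a f \<and> local_equation C' b g \<and>
         (n = 1 \<longrightarrow>
            smooth_branches_point f d \<and> singularity_type f [d] \<and>
            tacnode g d \<and> singularity_type g [d, d]) \<and>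
         (n \<ge> 2 \<longrightarrow>
            tacnode_of_order f d (n - 1) \<and> singularity_type f (replicate n d) \<and>
            blow_down_of_tacnode g d (n - 1) \<and> singularity_type g (d * n # replicate n d))"
    if d: "2 \<le> d"
  proof -
    let ?e1 = "vector [1, 0, 0] :: complex ^ 3" and ?e2 = "vector [0, 1, 0] :: complex ^ 3"
      and ?e3 = "vector [0, 0, 1] :: complex ^ 3"
    \<comment> \<open>The preimages under \<open>B\<close> of the two points at which all entries of
      \<open>uludag_map\<close> vanish.\<close>
    let ?a = "matrix_inv B *v ?e2" and ?b = "matrix_inv B *v ?e3"
    let ?f = "\<lambda>z :: complex ^ 2. G (vector [z $ 1, 1, z $ 2])" and ?g = "\<lambda>z :: complex ^ 2. G (vector [z $ 1, z $ 2, 1])"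
    have e: "?e2 \<noteq> 0" "?e3 \<noteq> 0"
      by (simp_all add: vec_eq_iff forall_3)
    have images: "B *v ?a = ?e2" "B *v ?b = ?e3"
      by (simp_all add: mult_matrix_inv_vector[OF B])
    then have ab: "?a \<noteq> 0" "?b \<noteq> 0"
      using e by (metis matrix_vector_mult_0_right)+
    have "proj_pt ?a \<noteq> proj_pt ?b"
    proof
      have "?a \<in> proj_pt ?a"
        unfolding proj_pt_def by (rule range_eqI[of _ _ 1]) simp
      moreover assume "proj_pt ?a = proj_pt ?b"
      ultimately obtain t where "?a = t *s ?b"
        by (auto simp: proj_pt_def)
      then have "?e2 = t *s ?e3"
        using images by (metis vector_scalar_commute)
      then show False
        by (simp add: vec_eq_iff forall_3)
    qed
    moreover have "singular_points C' = {proj_pt ?a, proj_pt ?b}"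
    proof -
      have "proj_pt (matrix_inv B *v w) \<in> {proj_pt ?a, proj_pt ?b}"
        if w: "w \<noteq> 0" "G w = 0" "gradient G w = 0" for w
      proof -
        have "w $ 1 = 0 \<and> (w $ 2 = 0 \<or> w $ 3 = 0)"
          using H_singular_imp[of w] w(2,3) by (simp add: G_def[abs_def])
        \<comment> \<open>Two coordinates of \<open>w\<close> vanish and the first is one of them,
          so \<open>w\<close> spans one of the two points.\<close>
        then have "w = w $ 3 *s ?e3 \<and> w $ 3 \<noteq> 0 \<or> w = w $ 2 *s ?e2 \<and> w $ 2 \<noteq> 0"
          using w(1) by (auto simp: vec_eq_iff forall_3)
        then have "matrix_inv B *v w = w $ 3 *s ?b \<and> w $ 3 \<noteq> 0 \<or> matrix_inv B *v w = w $ 2 *s ?a \<and> w $ 2 \<noteq> 0"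
          by (metis vector_scalar_commute)
        then show ?thesis
          using proj_pt_scale by (metis insertCI)
      qed
      moreover have "G ?e2 = 0" "gradient G ?e2 = 0" "G ?e3 = 0" "gradient G ?e3 = 0"
        using H_singularI[OF d uludag_map_center_1] H_singularI[OF d uludag_map_center_2]
        by (simp_all add: G_def[abs_def])
      ultimately show ?thesis
        unfolding C'_eq singular_points_linear[OF polyn_G B] using e by blast
    qed
    moreover have "local_equation C' ?a ?f" "local_equation C' ?b ?g"
    proof -
      have "?e2 + z $ 1 *s ?e1 + z $ 2 *s ?e3 = vector [z $ 1, 1, z $ 2]"
        "?e3 + z $ 1 *s ?e1 + z $ 2 *s ?e2 = vector [z $ 1, z $ 2, 1]" for z :: "complex ^ 2"
        by (simp_all add: vec_eq_iff forall_3)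
      moreover have "det (vector [?e2, ?e1, ?e3] :: complex ^ 3 ^ 3) \<noteq> 0" "det (vector [?e3, ?e1, ?e2] :: complex ^ 3 ^ 3) \<noteq> 0"
        by (simp_all add: det_3)
      ultimately show "local_equation C' ?a ?f" "local_equation C' ?b ?g"
        unfolding C'_eq
        using local_equation_linear[OF B, of ?e2 ?e1 ?e3 G] local_equation_linear[OF B, of ?e3 ?e1 ?e2 G]
        by simp_all
    qed
    moreover have "n = 1 \<longrightarrow>
        smooth_branches_point ?f d \<and> singularity_type ?f [d] \<and> tacnode ?g d \<and> singularity_type ?g [d, d]"
    proof
      assume n1: "n = 1"
      have "singularity_type ?f (replicate 1 d)"
        using center_1_singularity(1)[OF d] n1 by (simp only: G_def)
      moreover have "smooth_branches_point ?f d"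
        using center_1_singularity(2)[OF d] unfolding G_def smooth_branches_point_def by blast
      ultimately show "smooth_branches_point ?f d \<and> singularity_type ?f [d] \<and> tacnode ?g d \<and> singularity_type ?g [d, d]"
        using center_2_singularity_1[OF d n1] by (simp add: G_def del: singularity_type.simps)
    qed
    moreover have "2 \<le> n \<longrightarrow> tacnode_of_order ?f d (n - 1) \<and> singularity_type ?f (replicate n d) \<and>
        blow_down_of_tacnode ?g d (n - 1) \<and> singularity_type ?g (d * n # replicate n d)"
    proof
      assume n2: "2 \<le> n"
      have "tacnode_of_order ?f d (n - 1)"
        using center_1_singularity(2)[OF d] n2 d unfolding G_def tacnode_of_order_def by auto
      then show "tacnode_of_order ?f d (n - 1) \<and> singularity_type ?f (replicate n d) \<and>
          blow_down_of_tacnode ?g d (n - 1) \<and> singularity_type ?g (d * n # replicate n d)"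
        using center_1_singularity(1)[OF d] center_2_singularity[OF d n2]
        by (simp add: G_def del: singularity_type.simps)
    qed
    ultimately show ?thesis
      using ab by (intro exI[of _ ?a] exI[of _ ?b] exI[of _ ?f] exI[of _ ?g] conjI)
  qed
  ultimately show ?thesis by blast
qed

end
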